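(* (i) Let $\mathcal{D}$ be a quaternion division algebra over $\mathbb{Q}$. Then the group $\mathcal{D}^{\times}$ is a Jordan group and its Jordan constant satisfies $J_{\mathcal{D}^{\times}} \in \{1,2,12\}$. (ii) Let $\mathcal{D}$ be a quaternion division algebra over a quadratic number field. Then the group $\mathcal{D}^{\times}$ is a Jordan group and its Jordan constant satisfies $J_{\mathcal{D}^{\times}} \in \{1,2,12,24,60\}$.
   Context: A group $G$ is called a Jordan group if there exists an integer $d>0$, depending only on $G$, such that every finite subgroup $H$ of $G$ contains a normal abelian subgroup (normal in $H$) whose index in $H$ is at most $d$. The minimal such $d$ is called the Jordan constant of $G$ and is denoted by $J_G$. A quaternion algebra over a field $K$ is a central simple $K$-algebra of dimension $4$ over $K$; $\mathcal{D}^{\times}$ denotes the multiplicative group of invertible elements of $\mathcal{D}$. A quadratic number field is a field extension of $\mathbb{Q}$ of degree $2$ (real or imaginary). *)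

theory Defs
  imports "HOL-Algebra.Algebra" "HOL-Algebra.Algebraic_Closure_Type"
begin

section \<open>Jordan groups\<close>

definition jordan_bound :: "('a, 'm) monoid_scheme \<Rightarrow> nat \<Rightarrow> bool" where
  "jordan_bound G d \<longleftrightarrow>
     (\<forall>H. subgroup H G \<and> finite H \<longrightarrow>
        (\<exists>A. normal A (G\<lparr>carrier := H\<rparr>) \<and> comm_group (G\<lparr>carrier := A\<rparr>) \<and>
             card (rcosets\<^bsub>G\<lparr>carrier := H\<rparr>\<^esub> A) \<le> d))"

definition jordan_group :: "('a, 'm) monoid_scheme \<Rightarrow> bool" where
  "jordan_group G \<longleftrightarrow> group G \<and> (\<exists>d>0. jordan_bound G d)"

text \<open>The Jordan constant is only meaningful when \<^term>\<open>jordan_group G\<close> holds.\<close>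

definition jordan_constant :: "('a, 'm) monoid_scheme \<Rightarrow> nat" where
  "jordan_constant G = (LEAST d. d > 0 \<and> jordan_bound G d)"

section \<open>Quaternion algebras\<close>

definition ring_center :: "('a, 'm) ring_scheme \<Rightarrow> 'a set" where
  "ring_center R = {z \<in> carrier R. \<forall>x \<in> carrier R. z \<otimes>\<^bsub>R\<^esub> x = x \<otimes>\<^bsub>R\<^esub> z}"

definition simple_ring :: "('a, 'm) ring_scheme \<Rightarrow> bool" where
  "simple_ring R \<longleftrightarrow> ring R \<and> carrier R \<noteq> {\<zero>\<^bsub>R\<^esub>} \<and>
     (\<forall>I. ideal I R \<longrightarrow> I = {\<zero>\<^bsub>R\<^esub>} \<or> I = carrier R)"

text \<open>
  A \<open>K\<close>-algebra is given by a ring \<open>D\<close> together with a structure map \<open>\<phi>\<close>, a unital ring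
  homomorphism from \<open>K\<close> into the center of \<open>D\<close>; it is central if \<open>\<phi>\<close> maps onto the center.
  As \<open>K\<close> is a field, \<open>\<phi>\<close> is injective on it whenever \<open>D\<close> is nonzero, so the \<open>K\<close>-dimension of
  \<open>D\<close> is its dimension over the subfield \<open>\<phi> ` carrier K\<close>.
\<close>

definition quaternion_algebra ::
  "('k, 'm) ring_scheme \<Rightarrow> ('a, 'n) ring_scheme \<Rightarrow> ('k \<Rightarrow> 'a) \<Rightarrow> bool" where
  "quaternion_algebra K D \<phi> \<longleftrightarrow>
     field K \<and> simple_ring D \<and> \<phi> \<in> ring_hom K D \<and> \<phi> ` carrier K = ring_center D \<and>
     ring.dimension D 4 (\<phi> ` carrier K) (carrier D)"

definition quaternion_division_algebra ::
  "('k, 'm) ring_scheme \<Rightarrow> ('a, 'n) ring_scheme \<Rightarrow> ('k \<Rightarrow> 'a) \<Rightarrow> bool" where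
  "quaternion_division_algebra K D \<phi> \<longleftrightarrow>
     quaternion_algebra K D \<phi> \<and> Units D = carrier D - {\<zero>\<^bsub>D\<^esub>}"

section \<open>The rational numbers and quadratic number fields\<close>

abbreviation rat_field :: "rat ring" where
  "rat_field \<equiv> ring_of_type_algebra"

text \<open>Here \<open>\<iota>\<close> is the (necessarily unique and injective) embedding of the rationals into \<open>K\<close>.\<close>

definition quadratic_number_field :: "('k, 'm) ring_scheme \<Rightarrow> bool" where
  "quadratic_number_field K \<longleftrightarrow> field K \<and>
     (\<exists>\<iota> \<in> ring_hom rat_field K. ring.dimension K 2 (\<iota> ` carrier rat_field) (carrier K))"

end

theory Submission
  imports Defs
begin

text \<open>
  Let \<open>D\<close> be a skew field of dimension \<open>4\<close> over its centre \<open>F\<close>. The commutant of a noncentral element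
  \<open>x\<close> is the quadratic extension \<open>F + F x\<close>, hence commutative (\<open>commutant_quadratic\<close>,
  \<open>commutant_comm\<close>), and \<open>x\<close> has at most one conjugate other than itself in this field
  (\<open>commuting_conjugate\<close>). So a nonabelian finite subgroup \<open>H\<close> of the units has the following
  structure. The centralizers of its noncentral elements are its maximal abelian subgroups, they
  meet pairwise in the centre \<open>Z\<close>, and each of them has index \<open>1\<close> or \<open>2\<close> in its normalizer. The
  locale \<open>abelian_centralizers\<close> captures this structure.

  If some maximal abelian subgroup is normal, its index is at most \<open>2\<close>. Otherwise
  every abelian normal subgroup lies in \<open>Z\<close>, and the best possible index for \<open>H\<close> is
  \<open>N = [H : Z]\<close>. Counting the noncentral elements by conjugacy classes of maximal abelian
  subgroups \<open>A\<^sub>i\<close> gives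
  \<open>1 - 1/N = \<Sum> (1 - 1/a\<^sub>i)/e\<^sub>i\<close> with \<open>a\<^sub>i = [A\<^sub>i : Z] \<ge> 2\<close> and \<open>e\<^sub>i \<in> {1, 2}\<close>. This is the
  equation that classifies the finite rotation groups, and its solutions have
  \<open>N \<in> {12, 24, 60}\<close> (\<open>class_equation_solutions\<close>). The Jordan constant of the unit group is the maximum of the optimal indices over all finite subgroups
  (\<open>jordan_constant_among_indices\<close>).

  The solution \<open>N = 24\<close> has some \<open>a\<^sub>i = 4\<close> and \<open>N = 60\<close> has some \<open>a\<^sub>i = 5\<close>. Over the
  rational numbers these would require a primitive eighth or fifth root of unity, or too many
  square roots of \<open>-1\<close>, in a quadratic field. Such roots of unity need
  a rational square root of \<open>2\<close>, \<open>-2\<close> or \<open>5\<close>.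
\<close>

section \<open>The class equation of the finite rotation groups\<close>

text \<open>
The inequality \<open>2 * c < N\<close> excludes the dihedral family \<open>(2, 2, n)\<close>, for which \<open>N = 2 * n\<close>. What
is left are the triples familiar from the rotation groups of the tetrahedron, octahedron and
icosahedron.
\<close>

lemma platonic_triple:
  fixes a b c N :: nat
  assumes "2 \<le> a" "a \<le> b" "b \<le> c" "2 * c < N" "0 < N"
    and eq: "1 / real a + 1 / real b + 1 / real c = 1 + 2 / real N"
  shows "(a, b, c, N) \<in> {(2, 3, 3, 12), (2, 3, 4, 24), (2, 3, 5, 60)}"
proof -
  have gt: "1 / real a + 1 / real b + 1 / real c > 1" using eq \<open>0 < N\<close> by simp
  have "a = 2"
  proof (rule ccontr)
    assume "a \<noteq> 2"
    with assms have "1 / real a \<le> 1 / 3" "1 / real b \<le> 1 / 3" "1 / real c \<le> 1 / 3"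
      by (simp_all add: divide_simps)
    with gt show False by linarith
  qed
  have "b < 4"
  proof (rule ccontr)
    assume "\<not> b < 4"
    with assms have "1 / real b \<le> 1 / 4" "1 / real c \<le> 1 / 4" by (simp_all add: divide_simps)
    with gt \<open>a = 2\<close> show False by simp
  qed
  have "b \<noteq> 2"
  proof
    assume "b = 2"
    then have "1 / real c = 2 / real N" using eq \<open>a = 2\<close> by simp
    then have "1 * real N = 2 * real c" using assms by (subst (asm) frac_eq_eq) auto
    with assms show False by linarith
  qed
  with \<open>b < 4\<close> \<open>a = 2\<close> \<open>a \<le> b\<close> have "b = 3" by linarith
  have "c < 6"
  proof (rule ccontr)
    assume "\<not> c < 6"
    then have "1 / real c \<le> 1 / 6" by (simp add: divide_simps)
    with gt \<open>a = 2\<close> \<open>b = 3\<close> show False by simp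
  qed
  with \<open>b = 3\<close> \<open>b \<le> c\<close> have "c = 3 \<or> c = 4 \<or> c = 5" by linarith
  moreover have "2 / real N = 1 / real c - 1 / 6" using eq \<open>a = 2\<close> \<open>b = 3\<close> by simp
  then have "N = (if c = 3 then 12 else if c = 4 then 24 else 60)" if "c = 3 \<or> c = 4 \<or> c = 5"
    using that \<open>0 < N\<close> by (auto simp: divide_eq_eq split: if_splits)
  ultimately show ?thesis using \<open>a = 2\<close> \<open>b = 3\<close> by auto
qed

text \<open>
Here \<open>N\<close> stands for the order of a group modulo its centre, \<open>Q\<close> for the conjugacy classes of
its maximal abelian subgroups, \<open>a q\<close> for the order of such a subgroup modulo the centre and
\<open>e q\<close> for its index in its normalizer. Every summand is at least \<open>1 / 4\<close> and the sum is less
than \<open>1\<close>, so there are at most three classes. The hypothesis \<open>e q * a q < N\<close> says that no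
maximal abelian subgroup is normal; it removes the cyclic and dihedral solutions. Among the
surviving solutions with \<open>N = 12\<close> is also \<open>(2, 3, 3)\<close> with all \<open>e q = 2\<close>, which belongs to no
group; the tetrahedral group has two classes, with \<open>a = 2\<close>, \<open>e = 2\<close> and \<open>a = 3\<close>, \<open>e = 1\<close>.
\<close>

lemma class_equation_solutions:
  fixes a e :: "'i \<Rightarrow> nat" and N :: nat
  assumes fin: "finite Q" and N: "2 \<le> N"
    and e: "\<And>q. q \<in> Q \<Longrightarrow> e q = 1 \<or> e q = 2"
    and a: "\<And>q. q \<in> Q \<Longrightarrow> 2 \<le> a q"
    and less: "\<And>q. q \<in> Q \<Longrightarrow> e q * a q < N"
    and eq: "(\<Sum>q\<in>Q. (1 - 1 / real (a q)) / real (e q)) = 1 - 1 / real N"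
  shows "N = 12 \<or> N = 24 \<and> (\<exists>q\<in>Q. a q = 4) \<or> N = 60 \<and> (\<exists>q\<in>Q. a q = 5)"
proof -
  define f where "f q = (1 - 1 / real (a q)) / real (e q)" for q
  have f1: "f q \<ge> 1 / 2" "f q = 1 - 1 / real (a q)" if "q \<in> Q" "e q = 1" for q
    using a[OF that(1)] that(2) by (auto simp: f_def field_simps)
  have f2: "1 / 4 \<le> f q" "f q < 1 / 2" "f q = 1 / 2 - 1 / (2 * real (a q))" if "q \<in> Q" "e q = 2" for q
    using a[OF that(1)] that(2) by (auto simp: f_def field_simps)
  have f4: "f q \<ge> 1 / 4" if "q \<in> Q" for q
    using f1[OF that] f2[OF that] e[OF that] by fastforce
  have eq: "sum f Q = 1 - 1 / real N" using eq by (simp add: f_def)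
  have Npos: "1 / real N > 0" "1 / real N \<le> 1 / 2" using N by (auto simp: field_simps)
  have "real (card Q) * (1 / 4) \<le> sum f Q"
    using sum_bounded_below[of Q "1/4" f] f4 by simp
  then have "card Q < 4" using eq Npos by linarith
  then consider "card Q = 0" | "card Q = 1" | "card Q = 2" | "card Q = 3" by linarith
  then show ?thesis
  proof cases
    case 1
    then show ?thesis using fin eq Npos by auto
  next
    case 2
    then obtain p where Q: "Q = {p}" by (auto simp: card_1_singleton_iff)
    then have fp: "f p = 1 - 1 / real N" using eq by simp
    \<comment> \<open>A class with \<open>e p = 2\<close> contributes less than \<open>1 / 2\<close>, but the sum is at least \<open>1 / 2\<close>.\<close>
    have "e p = 1" using f2[of p] e[of p] Q fp Npos by force
    then have "real (a p) = real N" using f1[of p] fp Q N a[of p] by simp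
    then show ?thesis using less[of p] Q \<open>e p = 1\<close> by simp
  next
    case 3
    \<comment> \<open>One of the two centralizers is self-normalizing; up to order, it is the first.\<close>
    have key: ?thesis if Q: "Q = {p, q}" "p \<noteq> q" and ep: "e p = 1" for p q
    proof -
      have s: "f p + f q = 1 - 1 / real N" using eq Q by simp
      have eq2: "e q = 2"
      proof (rule ccontr)
        assume "e q \<noteq> 2"
        then have "f q \<ge> 1 / 2" using e[of q] f1(1)[of q] Q by auto
        with f1(1)[of p] Q ep s Npos show False by auto
      qed
      have fp: "f p = 1 - 1 / real (a p)" and fq: "f q = 1 / 2 - 1 / (2 * real (a q))"
        using f1 f2 Q ep eq2 by auto
      have ap: "2 \<le> a p" and aq: "2 \<le> a q" using a Q by auto
      have r: "1 / real (a p) + 1 / (2 * real (a q)) = 1 / 2 + 1 / real N" using s fp fq by linarith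
      have q4: "1 / (2 * real (a q)) \<le> 1 / 4" using aq by (simp add: divide_simps)
      have "a p < 4"
      proof (rule ccontr)
        assume "\<not> a p < 4"
        then have "1 / real (a p) \<le> 1 / 4" by (simp add: divide_simps)
        with r q4 Npos show False by linarith
      qed
      moreover have "a p \<noteq> 2"
      proof
        assume "a p = 2"
        with r have "1 / (2 * real (a q)) = 1 / real N" by simp
        then have "real N = real (2 * a q)" using aq N by (simp add: field_simps)
        with less[of q] Q eq2 show False by simp
      qed
      ultimately have ap3: "a p = 3" using ap by linarith
      have "a q < 3"
      proof (rule ccontr)
        assume "\<not> a q < 3"
        then have "1 / (2 * real (a q)) \<le> 1 / 6" by (simp add: divide_simps)
        with r ap3 Npos show False by simp
      qed
      then have "a q = 2" using aq by linarith
      with r ap3 have "1 / real N = 1 / 12" by simp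
      then show ?thesis using N by (simp add: field_simps)
    qed
    obtain p q where Q: "Q = {p, q}" "p \<noteq> q" using 3 by (auto simp: card_2_iff)
    consider "e p = 1" | "e q = 1" | "e p = 2" "e q = 2" using e[of p] e[of q] Q by auto
    then show ?thesis
    proof cases
      case 3
      have s: "f p + f q = 1 - 1 / real N" using eq Q by simp
      have "1 / real (a p) > 2 / real N" "1 / real (a q) > 2 / real N"
        using less[of p] less[of q] a[of p] a[of q] Q 3 N
        by (auto simp: divide_simps simp flip: of_nat_mult of_nat_less_iff)
      \<comment> \<open>The two strict bounds come from the subgroups not being normal and contradict this equation.\<close>
      moreover have "1 / real (a p) + 1 / real (a q) = 2 / real N"
        using s f2(3)[of p] f2(3)[of q] 3 Q by (simp add: field_simps)
      moreover have "2 / real N > 0" using Npos by simp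
      ultimately show ?thesis by linarith
    qed (use key Q in \<open>auto simp: insert_commute\<close>)
  next
    case 4
    have key: ?thesis if Q: "Q = {p, q, r}" "p \<noteq> q" "p \<noteq> r" "q \<noteq> r" and o: "a p \<le> a q" "a q \<le> a r" for p q r
    proof -
      have s: "f p + f q + f r = 1 - 1 / real N" using eq Q by simp
      have f4': "f p \<ge> 1 / 4" "f q \<ge> 1 / 4" "f r \<ge> 1 / 4" using f4 Q by auto
      have "f p < 1 / 2" "f q < 1 / 2" "f r < 1 / 2" using s f4' Npos by linarith+
      then have e2: "e p = 2" "e q = 2" "e r = 2"
        using e[of p] e[of q] e[of r] f1(1)[of p] f1(1)[of q] f1(1)[of r] Q by auto
      have "1 / real (a p) + 1 / real (a q) + 1 / real (a r) = 1 + 2 / real N"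
        using s f2(3)[of p] f2(3)[of q] f2(3)[of r] e2 Q by (simp add: field_simps)
      moreover have "2 \<le> a p" "2 * a r < N" "0 < N" using a[of p] less[of r] e2 N Q by auto
      ultimately have "(a p, a q, a r, N) \<in> {(2, 3, 3, 12), (2, 3, 4, 24), (2, 3, 5, 60)}"
        using platonic_triple o by blast
      then show ?thesis unfolding Q by auto
    qed
    obtain p q r where "Q = {p, q, r}" "p \<noteq> q" "q \<noteq> r" "p \<noteq> r"
      using 4 unfolding card_3_iff by blast
    note Q = this(1) this(2-4) this(2-4)[symmetric]
    show ?thesis
    proof (rule le_cases3[of "a p" "a q" "a r"])
      assume "a p \<le> a q" "a q \<le> a r"
      then show ?thesis using Q by (intro key[of p q r]) (auto simp only:)
    next
      assume "a q \<le> a p" "a p \<le> a r"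
      then show ?thesis using Q by (intro key[of q p r]) (auto simp only:)
    next
      assume "a p \<le> a r" "a r \<le> a q"
      then show ?thesis using Q by (intro key[of p r q]) (auto simp only:)
    next
      assume "a r \<le> a q" "a q \<le> a p"
      then show ?thesis using Q by (intro key[of r q p]) (auto simp only:)
    next
      assume "a q \<le> a r" "a r \<le> a p"
      then show ?thesis using Q by (intro key[of q r p]) (auto simp only:)
    next
      assume "a r \<le> a p" "a p \<le> a q"
      then show ?thesis using Q by (intro key[of r p q]) (auto simp only:)
    qed
  qed
qed

section \<open>Finite groups with abelian centralizers\<close>

definition (in monoid) centre :: "'a set" where
  "centre = {z \<in> carrier G. \<forall>x \<in> carrier G. z \<otimes> x = x \<otimes> z}"

definition (in monoid) centralizer :: "'a \<Rightarrow> 'a set" where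
  "centralizer x = {g \<in> carrier G. g \<otimes> x = x \<otimes> g}"

definition (in group) conj :: "'a \<Rightarrow> 'a \<Rightarrow> 'a" where
  "conj g x = g \<otimes> x \<otimes> inv g"

context group
begin

lemma conj_closed [simp]: "\<lbrakk>g \<in> carrier G; x \<in> carrier G\<rbrakk> \<Longrightarrow> conj g x \<in> carrier G"
  by (simp add: conj_def)

lemma conj_one [simp]: "x \<in> carrier G \<Longrightarrow> conj \<one> x = x"
  by (simp add: conj_def)

lemma conj_conj:
  "\<lbrakk>g \<in> carrier G; h \<in> carrier G; x \<in> carrier G\<rbrakk> \<Longrightarrow> conj g (conj h x) = conj (g \<otimes> h) x"
  by (simp add: conj_def m_assoc inv_mult_group)

lemma conj_mult:
  "\<lbrakk>g \<in> carrier G; x \<in> carrier G; y \<in> carrier G\<rbrakk> \<Longrightarrow> conj g (x \<otimes> y) = conj g x \<otimes> conj g y"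
  unfolding conj_def by (simp add: m_assoc) (simp add: m_assoc[symmetric])

lemma conj_inv_cancel [simp]:
  "\<lbrakk>g \<in> carrier G; x \<in> carrier G\<rbrakk> \<Longrightarrow> conj (inv g) (conj g x) = x"
  "\<lbrakk>g \<in> carrier G; x \<in> carrier G\<rbrakk> \<Longrightarrow> conj g (conj (inv g) x) = x"
  by (simp_all add: conj_conj)

lemma conj_eq_iff:
  "\<lbrakk>g \<in> carrier G; x \<in> carrier G; y \<in> carrier G\<rbrakk> \<Longrightarrow> conj g x = conj g y \<longleftrightarrow> x = y"
  by (metis conj_inv_cancel(1))

lemma conj_fixed_iff:
  "\<lbrakk>g \<in> carrier G; x \<in> carrier G\<rbrakk> \<Longrightarrow> conj g x = x \<longleftrightarrow> g \<in> centralizer x"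
  unfolding conj_def centralizer_def by (auto simp: inv_solve_right')

lemma centralizer_closed: "g \<in> centralizer x \<Longrightarrow> g \<in> carrier G"
  by (simp add: centralizer_def)

lemma centralizer_commute:
  "\<lbrakk>x \<in> carrier G; y \<in> carrier G\<rbrakk> \<Longrightarrow> x \<in> centralizer y \<longleftrightarrow> y \<in> centralizer x"
  by (auto simp: centralizer_def)

lemma conj_centralizer_iff:
  "\<lbrakk>g \<in> carrier G; x \<in> carrier G; y \<in> carrier G\<rbrakk>
    \<Longrightarrow> conj g x \<in> centralizer (conj g y) \<longleftrightarrow> x \<in> centralizer y"
  unfolding centralizer_def by (simp add: conj_mult[symmetric] conj_eq_iff)

lemma subgroup_centralizer:
  assumes "x \<in> carrier G" shows "subgroup (centralizer x) G"
proof (rule subgroupI)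
  show "inv g \<in> centralizer x" if g: "g \<in> centralizer x" for g
  proof -
    have gc: "g \<in> carrier G" using g by (rule centralizer_closed)
    then have "conj g x = x" using g assms conj_fixed_iff by blast
    then have "conj (inv g) x = x" using gc assms by (metis conj_inv_cancel(1))
    then show ?thesis using gc assms conj_fixed_iff by blast
  qed
  show "g \<otimes> h \<in> centralizer x" if "g \<in> centralizer x" "h \<in> centralizer x" for g h
    using that assms by (metis centralizer_closed conj_conj conj_fixed_iff m_closed)
qed (use assms in \<open>auto simp: centralizer_def\<close>)

lemma centre_conj [simp]: "\<lbrakk>z \<in> centre; g \<in> carrier G\<rbrakk> \<Longrightarrow> conj g z = z"
  by (simp add: conj_fixed_iff centre_def centralizer_def)

lemma conj_in_centre_iff:
  "\<lbrakk>g \<in> carrier G; x \<in> carrier G\<rbrakk> \<Longrightarrow> conj g x \<in> centre \<longleftrightarrow> x \<in> centre"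
  by (metis centre_conj conj_inv_cancel(1) inv_closed)

lemma centre_subset_centralizer: "x \<in> carrier G \<Longrightarrow> centre \<subseteq> centralizer x"
  by (auto simp: centre_def centralizer_def)

lemma subgroup_centre: "subgroup centre G"
proof (rule subgroupI)
  have eq: "centre = (\<Inter>x\<in>carrier G. centralizer x) \<inter> carrier G"
    by (auto simp: centre_def centralizer_def)
  show "inv g \<in> centre" if "g \<in> centre" for g
    using that subgroup_centralizer unfolding eq by (auto intro: subgroup.m_inv_closed)
  show "g \<otimes> h \<in> centre" if "g \<in> centre" "h \<in> centre" for g h
    using that subgroup_centralizer unfolding eq by (auto intro: subgroup.m_closed)
qed (auto simp: centre_def)

lemma normalI_conj:
  assumes "subgroup N G" "\<And>g x. \<lbrakk>g \<in> carrier G; x \<in> N\<rbrakk> \<Longrightarrow> conj g x \<in> N"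
  shows "N \<lhd> G"
  using assms by (simp add: normal_inv_iff conj_def)

lemma normal_conj: "\<lbrakk>N \<lhd> G; g \<in> carrier G; x \<in> N\<rbrakk> \<Longrightarrow> conj g x \<in> N"
  by (simp add: normal_inv_iff conj_def)

lemma comm_subgroupI:
  assumes "subgroup A G" "\<And>x y. \<lbrakk>x \<in> A; y \<in> A\<rbrakk> \<Longrightarrow> x \<otimes> y = y \<otimes> x"
  shows "comm_group (G\<lparr>carrier := A\<rparr>)"
  using group.group_comm_groupI[OF subgroup_imp_group[OF assms(1)]] assms(2) by simp

end

text \<open>
Groups in which commuting is transitive outside the centre: the centralizers of noncentral
elements are the maximal abelian subgroups, and any two distinct ones meet exactly in the centre. The
last assumption bounds the index of such a subgroup in its normalizer by \<open>2\<close>. In a quaternion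
algebra it reflects that a quadratic field extension has only one nontrivial automorphism.
Abelian groups satisfy both assumptions vacuously.
\<close>

locale abelian_centralizers = group +
  assumes finite_carrier: "finite (carrier G)"
    and centralizer_comm: "\<lbrakk>x \<in> carrier G - centre; y \<in> centralizer x; z \<in> centralizer x\<rbrakk>
          \<Longrightarrow> y \<otimes> z = z \<otimes> y"
    and commuting_conj_unique:
      "\<lbrakk>x \<in> carrier G - centre; g \<in> carrier G; h \<in> carrier G;
        conj g x \<in> centralizer x; conj h x \<in> centralizer x; conj g x \<noteq> x; conj h x \<noteq> x\<rbrakk>
          \<Longrightarrow> conj g x = conj h x"
begin

text \<open>
By transitivity of commuting, this set is the normalizer of the centralizer of \<open>x\<close> when \<open>x\<close> is
noncentral: a conjugate of \<open>x\<close> in the abelian group \<open>centralizer x\<close> has the same centralizer.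
\<close>

definition normalizing :: "'a \<Rightarrow> 'a set" where
  "normalizing x = {g \<in> carrier G. conj g x \<in> centralizer x}"

text \<open>
The relation that the centralizers of \<open>x\<close> and \<open>y\<close> are conjugate subgroups.
\<close>

definition linked :: "('a \<times> 'a) set" where
  "linked = {(x, y). x \<in> carrier G - centre \<and> y \<in> carrier G - centre \<and>
              (\<exists>g\<in>carrier G. conj g x \<in> centralizer y)}"

lemma commute_trans:
  assumes "y \<in> carrier G - centre" "x \<in> centralizer y" "z \<in> centralizer y"
  shows "x \<in> centralizer z"
  using centralizer_comm[OF assms] assms by (auto simp: centralizer_def)

lemma centralizer_eq:
  assumes "x \<in> carrier G - centre" "y \<in> carrier G - centre" "x \<in> centralizer y"
  shows "centralizer x = centralizer y"
  using assms by (meson DiffD1 centralizer_closed centralizer_commute commute_trans subsetI subset_antisym)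

lemma equiv_linked: "equiv (carrier G - centre) linked"
proof (rule equivI)
  show "linked \<subseteq> (carrier G - centre) \<times> (carrier G - centre)" by (auto simp: linked_def)
  show "refl_on (carrier G - centre) linked"
    by (rule refl_onI) (auto simp: linked_def centralizer_def intro!: bexI[of _ \<one>])
  show "sym linked"
  proof (rule symI)
    fix x y assume "(x, y) \<in> linked"
    then obtain g where g: "x \<in> carrier G - centre" "y \<in> carrier G - centre" "g \<in> carrier G"
        "conj g x \<in> centralizer y"
      by (auto simp: linked_def)
    then have "conj (inv g) y \<in> centralizer (conj (inv g) (conj g x))"
      by (subst conj_centralizer_iff) (auto simp: centralizer_commute[of y])
    with g show "(y, x) \<in> linked" by (auto simp: linked_def intro!: bexI[of _ "inv g"])
  qed
  show "trans linked"
  proof (rule transI)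
    fix x y z assume "(x, y) \<in> linked" "(y, z) \<in> linked"
    then obtain g h where g: "x \<in> carrier G - centre" "y \<in> carrier G - centre" "g \<in> carrier G"
        "conj g x \<in> centralizer y" and h: "z \<in> carrier G - centre" "h \<in> carrier G"
        "conj h y \<in> centralizer z"
      by (auto simp: linked_def)
    have "conj h (conj g x) \<in> centralizer (conj h y)"
      using g h by (simp add: conj_centralizer_iff)
    moreover have "conj h y \<in> carrier G - centre" using g h by (simp add: conj_in_centre_iff)
    ultimately have "conj h (conj g x) \<in> centralizer z"
      using h g centralizer_eq[of "conj h y" z] by blast
    with g h show "(x, z) \<in> linked"
      by (auto simp: linked_def conj_conj intro!: bexI[of _ "h \<otimes> g"])
  qed
qed

text \<open>
Two elements that move \<open>x\<close> inside its centralizer send it to the same place, so they differ by an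
element of the centralizer. Hence the elements of \<open>normalizing x\<close> outside \<open>centralizer x\<close> form at
most one coset.
\<close>

lemma card_normalizing:
  assumes x: "x \<in> carrier G - centre"
  shows "\<exists>e\<in>{1, 2}. card (normalizing x) = e * card (centralizer x)"
proof (cases "normalizing x = centralizer x")
  case True
  then show ?thesis by auto
next
  case False
  have xc: "x \<in> carrier G" using x by simp
  have sub: "centralizer x \<subseteq> normalizing x"
  proof
    fix g assume g: "g \<in> centralizer x"
    then have "conj g x = x" using xc by (simp add: conj_fixed_iff centralizer_closed)
    then show "g \<in> normalizing x"
      using g xc by (simp add: normalizing_def centralizer_def)
  qed
  with False obtain g where g: "g \<in> normalizing x" "g \<notin> centralizer x" by blast
  have gc: "g \<in> carrier G" "conj g x \<in> centralizer x" using g by (auto simp: normalizing_def)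
  have eq: "normalizing x - centralizer x = (\<lambda>c. g \<otimes> c) ` centralizer x"
  proof safe
    fix h assume h: "h \<in> normalizing x" "h \<notin> centralizer x"
    have hc: "h \<in> carrier G" using h by (auto simp: normalizing_def)
    have "conj h x = conj g x"
      using commuting_conj_unique[OF x, of h g] g h x
      by (auto simp: normalizing_def conj_fixed_iff)
    then have "conj (inv g) (conj h x) = x" using gc xc by simp
    then have "inv g \<otimes> h \<in> centralizer x" using gc hc xc by (simp add: conj_conj conj_fixed_iff)
    moreover have "h = g \<otimes> (inv g \<otimes> h)" using gc hc by (simp add: m_assoc[symmetric])
    ultimately show "h \<in> (\<lambda>c. g \<otimes> c) ` centralizer x" by blast
  next
    fix c assume c: "c \<in> centralizer x"
    have cc: "c \<in> carrier G" using c by (rule centralizer_closed)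
    have "conj c x = x" using c cc xc by (simp add: conj_fixed_iff)
    then have "conj (g \<otimes> c) x = conj g x"
      using cc gc xc by (simp add: conj_conj[symmetric])
    then show "g \<otimes> c \<in> normalizing x" using gc cc by (simp add: normalizing_def)
    assume "g \<otimes> c \<in> centralizer x"
    then have "conj (g \<otimes> c) x = x" using xc cc gc by (simp add: conj_fixed_iff)
    with \<open>conj (g \<otimes> c) x = conj g x\<close> have "conj g x = x" by simp
    with g gc xc show False by (simp add: conj_fixed_iff)
  qed
  have "inj_on (\<lambda>c. g \<otimes> c) (centralizer x)"
    using gc by (intro inj_onI) (metis centralizer_closed l_cancel)
  then have "card (normalizing x - centralizer x) = card (centralizer x)"
    unfolding eq by (rule card_image)
  moreover have fin: "finite (normalizing x)" by (simp add: normalizing_def finite_carrier)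
  then have "finite (centralizer x)" using sub finite_subset by blast
  then have "card (normalizing x - centralizer x) = card (normalizing x) - card (centralizer x)"
    using sub by (rule card_Diff_subset)
  moreover have "card (centralizer x) \<le> card (normalizing x)" using fin sub by (rule card_mono)
  ultimately have "card (normalizing x) = 2 * card (centralizer x)" by linarith
  then show ?thesis by blast
qed

text \<open>
Double counting of the pairs \<open>(g, y)\<close> for which \<open>g\<close> conjugates the noncentral element \<open>y\<close> into
\<open>centralizer x\<close>. For fixed \<open>g\<close>, the possible \<open>y\<close> correspond under conjugation to the noncentral
elements of \<open>centralizer x\<close>; for fixed \<open>y\<close> in the class of \<open>x\<close>, the possible \<open>g\<close> form a coset of
\<open>normalizing x\<close>.
\<close>

lemma card_linked_class:
  assumes x: "x \<in> carrier G - centre"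
  shows "card (carrier G) * (card (centralizer x) - card centre)
           = card (normalizing x) * card (linked `` {x})"
proof -
  have xc: "x \<in> carrier G" using x by simp
  let ?W = "linked `` {x}"
  have W: "(x, y) \<in> linked \<longleftrightarrow> y \<in> carrier G - centre \<and> (\<exists>g\<in>carrier G. conj g y \<in> centralizer x)" for y
  proof -
    have "(x, y) \<in> linked \<longleftrightarrow> (y, x) \<in> linked"
      using equiv_linked by (meson equivE symD)
    then show ?thesis using x by (auto simp: linked_def)
  qed
  have "?W \<subseteq> carrier G" by (auto simp: linked_def)
  then have fin: "finite ?W" using finite_carrier by (rule finite_subset)
  have fibre1: "card {y \<in> ?W. conj g y \<in> centralizer x} = card (centralizer x) - card centre"
    if g: "g \<in> carrier G" for g
  proof -
    have "bij_betw (conj g) {y \<in> ?W. conj g y \<in> centralizer x} (centralizer x - centre)"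
    proof (rule bij_betwI[where g = "conj (inv g)"])
      show "conj (inv g) \<in> centralizer x - centre \<rightarrow> {y \<in> ?W. conj g y \<in> centralizer x}"
        using g by (auto simp: W conj_in_centre_iff centralizer_closed intro!: bexI[of _ g])
    qed (use g in \<open>auto simp: W conj_in_centre_iff centralizer_closed\<close>)
    then have "card {y \<in> ?W. conj g y \<in> centralizer x} = card (centralizer x - centre)"
      by (rule bij_betw_same_card)
    then show ?thesis
      using centre_subset_centralizer[OF xc] finite_carrier
      by (simp add: card_Diff_subset centre_def)
  qed
  have fibre2: "card {g \<in> carrier G. conj g y \<in> centralizer x} = card (normalizing x)"
    if "y \<in> ?W" for y
  proof -
    have y: "(x, y) \<in> linked" using that by simp
    obtain k where k: "k \<in> carrier G" "conj k y \<in> centralizer x" using y W by blast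
    have yc: "y \<in> carrier G" "y \<notin> centre" using y W by auto
    let ?c = "conj k y"
    have c: "?c \<in> carrier G - centre" using k yc by (simp add: conj_in_centre_iff)
    have cx: "centralizer ?c = centralizer x" using centralizer_eq[OF c x] k by blast
    have iff: "conj h ?c \<in> centralizer x \<longleftrightarrow> conj h x \<in> centralizer x" if h: "h \<in> carrier G" for h
    proof -
      have 1: "conj h ?c \<in> carrier G - centre" "conj h x \<in> carrier G - centre"
        using h c x by (auto simp: conj_in_centre_iff)
      have "conj h ?c \<in> centralizer (conj h x)"
        using k h xc c by (simp add: conj_centralizer_iff)
      then have "centralizer (conj h ?c) = centralizer (conj h x)" using centralizer_eq 1 by blast
      then show ?thesis using 1 xc by (metis DiffD1 centralizer_commute)
    qed
    have "bij_betw (\<lambda>h. h \<otimes> k) (normalizing x) {g \<in> carrier G. conj g y \<in> centralizer x}"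
    proof (rule bij_betwI[where g = "\<lambda>g. g \<otimes> inv k"])
      show "(\<lambda>h. h \<otimes> k) \<in> normalizing x \<rightarrow> {g \<in> carrier G. conj g y \<in> centralizer x}"
        using k yc iff by (auto simp: normalizing_def conj_conj)
      show "(\<lambda>g. g \<otimes> inv k) \<in> {g \<in> carrier G. conj g y \<in> centralizer x} \<rightarrow> normalizing x"
        using k yc iff by (auto simp: normalizing_def conj_conj m_assoc simp flip: iff)
    qed (use k in \<open>auto simp: m_assoc normalizing_def\<close>)
    then show ?thesis by (rule bij_betw_same_card[symmetric])
  qed
  have "(\<Sum>g\<in>carrier G. card {y \<in> ?W. conj g y \<in> centralizer x}) = card (normalizing x) * card ?W"
    by (rule sum_multicount) (use fin finite_carrier fibre2 in auto)
  then show ?thesis using fibre1 by simp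
qed

end

section \<open>Abelian normal subgroups of least index\<close>

text \<open>
The optimal constant for the single finite group \<open>G\<close>: some abelian normal subgroup has index \<open>d\<close>
and none has smaller index.
\<close>

definition least_abelian_index :: "('a, 'm) monoid_scheme \<Rightarrow> nat \<Rightarrow> bool" where
  "least_abelian_index G d \<longleftrightarrow>
     (\<exists>A. A \<lhd> G \<and> comm_group (G\<lparr>carrier := A\<rparr>) \<and> card (rcosets\<^bsub>G\<^esub> A) = d) \<and>
     (\<forall>A. A \<lhd> G \<and> comm_group (G\<lparr>carrier := A\<rparr>) \<longrightarrow> d \<le> card (rcosets\<^bsub>G\<^esub> A))"

lemma least_abelian_indexI:
  assumes "A \<lhd> G" "comm_group (G\<lparr>carrier := A\<rparr>)" "card (rcosets\<^bsub>G\<^esub> A) = d"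
    and "\<And>A'. \<lbrakk>A' \<lhd> G; comm_group (G\<lparr>carrier := A'\<rparr>)\<rbrakk> \<Longrightarrow> d \<le> card (rcosets\<^bsub>G\<^esub> A')"
  shows "least_abelian_index G d"
  using assms unfolding least_abelian_index_def by blast

context abelian_centralizers
begin

lemma card_carrier_pos: "card (carrier G) > 0"
  using finite_carrier one_closed card_gt_0_iff by blast

lemma card_rcosets:
  assumes "subgroup A G" "card (carrier G) = k * card A"
  shows "card (rcosets A) = k"
  using lagrange[OF assms(1)] assms card_carrier_pos by (simp add: Coset.order_def)

lemma card_centre_dvd:
  assumes "x \<in> carrier G" shows "card centre dvd card (centralizer x)"
proof -
  interpret C: group "G\<lparr>carrier := centralizer x\<rparr>"
    using subgroup_centralizer[OF assms] by (rule subgroup_imp_group)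
  have "subgroup centre (G\<lparr>carrier := centralizer x\<rparr>)"
    using subgroup_incl[OF subgroup_centre subgroup_centralizer[OF assms]]
      centre_subset_centralizer[OF assms] by blast
  then have "card (rcosets\<^bsub>G\<lparr>carrier := centralizer x\<rparr>\<^esub> centre) * card centre = card (centralizer x)"
    using C.lagrange[of centre] by (simp add: Coset.order_def)
  then show ?thesis by (metis dvd_triv_right)
qed

lemma card_centre_pos: "card centre > 0"
  using subgroup_centre finite_carrier 
  by (auto simp: card_gt_0_iff centre_def)

text \<open>
The noncentral elements are partitioned by \<open>linked\<close>. Dividing the resulting count by the order
of the group gives the class equation whose solutions are known.
\<close>

lemma index_centre:
  assumes nonabelian: "centre \<noteq> carrier G"
    and moves: "\<And>x. x \<in> carrier G - centre \<Longrightarrow> normalizing x \<noteq> carrier G"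
  obtains N where "card (carrier G) = N * card centre"
    "N = 12 \<or> N = 24 \<and> (\<exists>x\<in>carrier G - centre. card (centralizer x) = 4 * card centre) \<or>
     N = 60 \<and> (\<exists>x\<in>carrier G - centre. card (centralizer x) = 5 * card centre)"
proof -
  define z where "z = card centre"
  define Q where "Q = (carrier G - centre) // linked"
  define r where "r W = (SOME x. x \<in> W)" for W :: "'a set"
  define a where "a W = card (centralizer (r W)) div z" for W
  define e where "e W = card (normalizing (r W)) div card (centralizer (r W))" for W
  have z: "z > 0" unfolding z_def by (rule card_centre_pos)
  obtain N where N: "card (carrier G) = N * z"
    using lagrange[OF subgroup_centre] unfolding z_def Coset.order_def by metis
  have r: "r W \<in> carrier G - centre" "linked `` {r W} = W" if W: "W \<in> Q" for W
  proof -
    obtain y where y: "y \<in> carrier G - centre" "W = linked `` {y}"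
      using W unfolding Q_def by (elim quotientE)
    then have "y \<in> W" using equiv_class_self[OF equiv_linked] by simp
    then have "r W \<in> W" unfolding r_def by (rule someI)
    then have "(y, r W) \<in> linked" using y by simp
    then have "linked `` {y} = linked `` {r W}" by (rule equiv_class_eq[OF equiv_linked])
    then show "linked `` {r W} = W" by (rule trans[OF y(2), symmetric])
    show "r W \<in> carrier G - centre" using \<open>(y, r W) \<in> linked\<close> by (simp add: linked_def)
  qed
  have cent: "card (centralizer (r W)) = a W * z" if W: "W \<in> Q" for W
  proof -
    have "z dvd card (centralizer (r W))"
      using card_centre_dvd[of "r W"] r(1)[OF W] unfolding z_def by blast
    then show ?thesis by (simp only: a_def dvd_div_mult_self)
  qed
  have a2: "2 \<le> a W" if W: "W \<in> Q" for W
  proof -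
    have "r W \<in> centralizer (r W)" using r(1)[OF W] by (simp add: centralizer_def)
    then have "centre \<subset> centralizer (r W)" using r(1)[OF W] centre_subset_centralizer by blast
    moreover have "finite (centralizer (r W))" using finite_carrier by (simp add: centralizer_def)
    ultimately have "z < card (centralizer (r W))" unfolding z_def by (intro psubset_card_mono)
    then have "1 * z < a W * z" using cent[OF W] by simp
    then show ?thesis unfolding mult_less_cancel2 by linarith
  qed
  have norm: "card (normalizing (r W)) = e W * (a W * z)" "e W = 1 \<or> e W = 2" if W: "W \<in> Q" for W
  proof -
    obtain i where i: "i \<in> {1, 2}" "card (normalizing (r W)) = i * card (centralizer (r W))"
      using card_normalizing[OF r(1)[OF W]] by blast
    have "card (centralizer (r W)) \<noteq> 0" using cent[OF W] a2[OF W] z by simp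
    then have "e W = i" unfolding e_def i(2) by simp
    then show "card (normalizing (r W)) = e W * (a W * z)" "e W = 1 \<or> e W = 2"
      using i cent[OF W] by auto
  qed
  have less: "e W * a W < N" if W: "W \<in> Q" for W
  proof -
    have "normalizing (r W) \<subset> carrier G" using moves[OF r(1)[OF W]] by (auto simp: normalizing_def)
    then have "card (normalizing (r W)) < card (carrier G)"
      using finite_carrier by (intro psubset_card_mono)
    then show ?thesis using norm(1)[OF W] N by (simp flip: mult.assoc)
  qed
  have "z < card (carrier G)"
    using nonabelian finite_carrier subgroup.subset[OF subgroup_centre]
    unfolding z_def by (intro psubset_card_mono) auto
  then have "1 * z < N * z" using N by simp
  then have N2: "2 \<le> N" unfolding mult_less_cancel2 by linarith
  have finQ: "finite Q"
    using finite_carrier equiv_linked unfolding Q_def by (simp add: finite_quotient equiv_type)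
  have frac: "(1 - 1 / real (a W)) / real (e W) = real (card W) / real (N * z)" if W: "W \<in> Q" for W
  proof -
    have "N * z * (a W * z - z) = e W * (a W * z) * card W"
      using card_linked_class[OF r(1)[OF W]] r(2)[OF W] norm(1)[OF W] cent[OF W] N z_def by simp
    moreover have "a W * z - z = (a W - 1) * z" by (simp add: diff_mult_distrib)
    ultimately have "(N * z * (a W - 1)) * z = (e W * a W * card W) * z" by (simp add: mult_ac)
    then have "N * z * (a W - 1) = e W * a W * card W" using z
      by (metis less_irrefl mult_cancel2)
    then have "real (N * z) * real (a W - 1) = real (e W) * real (a W) * real (card W)"
      by (simp only: of_nat_mult[symmetric])
    then have "real (N * z) * (real (a W) - 1) = real (e W) * real (a W) * real (card W)"
      using a2[OF W] by (simp add: of_nat_diff)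
    moreover have "real (a W) * real (e W) \<noteq> 0" "real (N * z) \<noteq> 0"
      using a2[OF W] norm(2)[OF W] N2 z by auto
    moreover have eq: "1 - 1 / real (a W) = (real (a W) - 1) / real (a W)"
      using a2[OF W] by (simp add: diff_divide_distrib)
    ultimately have "(real (a W) - 1) / (real (a W) * real (e W)) = real (card W) / real (N * z)"
      by (subst frac_eq_eq) (auto simp: mult_ac)
    with eq show ?thesis by (simp only: divide_divide_eq_left)
  qed
  have "(\<Sum>W\<in>Q. card W) = card (carrier G - centre)"
  proof -
    have "card (\<Union>Q) = (\<Sum>W\<in>Q. card W)"
    proof (rule card_Union_disjoint)
      show "pairwise disjnt Q"
        using quotient_disj[OF equiv_linked] unfolding Q_def pairwise_def disjnt_def by blast
      show "finite W" if "W \<in> Q" for W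
        using that in_quotient_imp_subset[OF equiv_linked] finite_carrier unfolding Q_def
        by (meson finite_Diff finite_subset)
    qed
    then show ?thesis using Union_quotient[OF equiv_linked] by (simp add: Q_def)
  qed
  also have "\<dots> = N * z - z"
    using N subgroup.subset[OF subgroup_centre] finite_carrier
    by (simp add: card_Diff_subset finite_subset z_def)
  finally have "(\<Sum>W\<in>Q. real (card W)) = real N * real z - real z"
    using N2 by (simp flip: of_nat_sum add: of_nat_diff)
  then have "(\<Sum>W\<in>Q. (1 - 1 / real (a W)) / real (e W)) = (real N * real z - real z) / real (N * z)"
    by (simp add: frac sum_divide_distrib[symmetric])
  also have "\<dots> = 1 - 1 / real N" using z N2 by (simp add: diff_divide_distrib)
  finally have sum_eq: "(\<Sum>W\<in>Q. (1 - 1 / real (a W)) / real (e W)) = 1 - 1 / real N" .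
  note solutions = class_equation_solutions[OF finQ N2 norm(2) a2 less sum_eq]
  have witness: "\<exists>x\<in>carrier G - centre. card (centralizer x) = k * card centre"
    if ex: "\<exists>W\<in>Q. a W = k" for k
  proof -
    obtain W where "W \<in> Q" "a W = k" using ex by blast
    then show ?thesis using r(1) cent unfolding z_def by blast
  qed
  from solutions witness[of 4] witness[of 5] have "N = 12 \<or>
      N = 24 \<and> (\<exists>x\<in>carrier G - centre. card (centralizer x) = 4 * card centre) \<or>
      N = 60 \<and> (\<exists>x\<in>carrier G - centre. card (centralizer x) = 5 * card centre)"
    by blast
  then show thesis by (rule that[OF N[unfolded z_def]])
qed

text \<open>
An abelian normal subgroup that contains a noncentral element \<open>x\<close> forces all conjugates of \<open>x\<close> to
commute with \<open>x\<close>, that is, \<open>normalizing x = carrier G\<close>; then \<open>centralizer x\<close> is itself a normal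
abelian subgroup of index at most \<open>2\<close>. If this never happens, all abelian normal subgroups are
central, so the optimum is the index of the centre. The additional information for \<open>24\<close> and
\<open>60\<close> serves to exclude these values over the rational numbers.
\<close>

lemma least_abelian_index_cases:
  "\<exists>d\<in>{1, 2, 12, 24, 60}. least_abelian_index G d \<and>
     (d = 24 \<longrightarrow> (\<exists>x\<in>carrier G - centre. card (centralizer x) = 4 * card centre)) \<and>
     (d = 60 \<longrightarrow> (\<exists>x\<in>carrier G - centre. card (centralizer x) = 5 * card centre))"
proof -
  have pos: "1 \<le> card (rcosets A)" if "A \<lhd> G" for A
  proof -
    have "card (rcosets A) * card A = card (carrier G)"
      using lagrange[OF normal_imp_subgroup[OF that]] unfolding Coset.order_def .
    then have "card (rcosets A) \<noteq> 0" using card_carrier_pos by (metis mult_0 less_irrefl)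
    then show ?thesis by linarith
  qed
  consider (comm) "centre = carrier G"
    | (normal) x where "centre \<noteq> carrier G" "x \<in> carrier G - centre" "normalizing x = carrier G"
    | (moves) "centre \<noteq> carrier G" "\<And>x. x \<in> carrier G - centre \<Longrightarrow> normalizing x \<noteq> carrier G"
    by blast
  then show ?thesis
  proof cases
    case comm
    have "comm_group (G\<lparr>carrier := carrier G\<rparr>)"
      using subgroup_self comm by (intro comm_subgroupI) (auto simp: centre_def)
    moreover have "carrier G \<lhd> G" by (rule normalI_conj) (auto intro: subgroup_self)
    moreover have "card (rcosets carrier G) = 1" by (rule card_rcosets) (auto intro: subgroup_self)
    ultimately have "least_abelian_index G 1" using pos by (intro least_abelian_indexI)
    then show ?thesis by auto
  next
    case normal
    have xc: "x \<in> carrier G" using normal by simp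
    obtain e where e: "e = 1 \<or> e = 2" "card (carrier G) = e * card (centralizer x)"
      using card_normalizing[OF normal(2)] unfolding normal(3) by blast
    have "centralizer x \<lhd> G"
    proof (rule normalI_conj[OF subgroup_centralizer[OF xc]])
      fix g y assume g: "g \<in> carrier G" and y: "y \<in> centralizer x"
      then have gx: "conj g x \<in> carrier G - centre" "conj g x \<in> centralizer x"
        using normal by (auto simp: normalizing_def conj_in_centre_iff)
      have "conj g y \<in> centralizer (conj g x)"
        using g y xc by (simp add: conj_centralizer_iff centralizer_closed)
      then show "conj g y \<in> centralizer x" using centralizer_eq[OF gx(1) normal(2) gx(2)] by simp
    qed
    moreover have "comm_group (G\<lparr>carrier := centralizer x\<rparr>)"
      using subgroup_centralizer[OF xc] centralizer_comm[OF normal(2)] by (rule comm_subgroupI)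
    moreover have "card (rcosets (centralizer x)) = e"
      using subgroup_centralizer[OF xc] e(2) by (rule card_rcosets)
    moreover have "e \<le> card (rcosets A)" if A: "A \<lhd> G" "comm_group (G\<lparr>carrier := A\<rparr>)" for A
    proof (rule ccontr)
      assume "\<not> e \<le> card (rcosets A)"
      then have "card (rcosets A) = 1" using e pos[OF A(1)] by linarith
      then have "card A = card (carrier G)"
        using lagrange[OF normal_imp_subgroup[OF A(1)]] by (simp add: Coset.order_def)
      then have "A = carrier G"
        using subgroup.subset[OF normal_imp_subgroup[OF A(1)]] finite_carrier by (simp add: card_subset_eq)
      then have "centre = carrier G"
        using comm_groupE(4)[OF A(2)] by (auto simp: centre_def)
      then show False using normal(1) by simp
    qed
    ultimately have "least_abelian_index G e" by (rule least_abelian_indexI)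
    then show ?thesis using e(1) by auto
  next
    case moves
    obtain N where N: "card (carrier G) = N * card centre"
      "N = 12 \<or> N = 24 \<and> (\<exists>x\<in>carrier G - centre. card (centralizer x) = 4 * card centre) \<or>
       N = 60 \<and> (\<exists>x\<in>carrier G - centre. card (centralizer x) = 5 * card centre)"
      using index_centre[OF moves] by blast
    have central: "A \<subseteq> centre" if A: "A \<lhd> G" "comm_group (G\<lparr>carrier := A\<rparr>)" for A
    proof
      fix x assume x: "x \<in> A"
      have xc: "x \<in> carrier G" using subgroup.subset[OF normal_imp_subgroup[OF A(1)]] x by auto
      have "conj g x \<in> centralizer x" if "g \<in> carrier G" for g
        using normal_conj[OF A(1) that x] comm_groupE(4)[OF A(2)] x that xc
        by (auto simp: centralizer_def)
      then have "normalizing x = carrier G" by (auto simp: normalizing_def)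
      then show "x \<in> centre" using moves(2) xc by blast
    qed
    have "N \<le> card (rcosets A)" if A: "A \<lhd> G" "comm_group (G\<lparr>carrier := A\<rparr>)" for A
    proof -
      have fc: "finite centre" using finite_carrier by (simp add: centre_def)
      have "N * card centre = card (rcosets A) * card A"
        using lagrange[OF normal_imp_subgroup[OF A(1)]] N(1) by (simp add: Coset.order_def)
      also have "\<dots> \<le> card (rcosets A) * card centre"
        using card_mono[OF fc central[OF A]] by simp
      finally show ?thesis using card_centre_pos by simp
    qed
    moreover have "centre \<lhd> G" by (rule normalI_conj[OF subgroup_centre]) simp
    moreover have "comm_group (G\<lparr>carrier := centre\<rparr>)"
      using subgroup_centre by (rule comm_subgroupI) (unfold centre_def, blast)
    moreover have "card (rcosets centre) = N" using subgroup_centre N(1) by (rule card_rcosets)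
    ultimately have "least_abelian_index G N" by (rule least_abelian_indexI[rotated 3])
    then show ?thesis using N(2) by auto
  qed
qed

end

section \<open>Skew fields of dimension four over their centre\<close>

locale skew_field = ring +
  assumes Units_eq: "Units R = carrier R - {\<zero>}"
begin

lemma one_neq_zero: "\<one> \<noteq> \<zero>"
  using Units_eq Units_one_closed by auto

lemma inv_nonzero:
  assumes "a \<in> carrier R" "a \<noteq> \<zero>"
  shows "inv a \<in> carrier R" "inv a \<otimes> a = \<one>" "a \<otimes> inv a = \<one>" "inv a \<noteq> \<zero>"
proof -
  have a: "a \<in> Units R" using assms Units_eq by simp
  then show "inv a \<in> carrier R" "inv a \<otimes> a = \<one>" "a \<otimes> inv a = \<one>" by simp_all
  show "inv a \<noteq> \<zero>" using Units_inv_Units[OF a] Units_eq by simp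
qed

lemma mult_eq_zero:
  assumes "a \<in> carrier R" "b \<in> carrier R" "a \<otimes> b = \<zero>"
  shows "a = \<zero> \<or> b = \<zero>"
proof (rule ccontr)
  assume "\<not> (a = \<zero> \<or> b = \<zero>)"
  then have n: "a \<noteq> \<zero>" "b \<noteq> \<zero>" by auto
  note i = inv_nonzero[OF assms(1) n(1)]
  have "inv a \<otimes> (a \<otimes> b) = b" using i assms(1,2) by (simp flip: m_assoc)
  then have "b = \<zero>" using i assms(3) by simp
  with n show False by simp
qed

lemma square_eq_one:
  assumes a: "a \<in> carrier R" and eq: "a \<otimes> a = \<one>"
  shows "a = \<one> \<or> a = \<ominus> \<one>"
proof -
  have "(a \<ominus> \<one>) \<otimes> (a \<oplus> \<one>) = a \<otimes> a \<ominus> \<one>"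
    using a by (simp add: a_minus_def l_distr r_distr l_minus) algebra
  then have "(a \<ominus> \<one>) \<otimes> (a \<oplus> \<one>) = \<zero>" using eq by (simp add: r_neg a_minus_def)
  then consider "a \<ominus> \<one> = \<zero>" | "a \<oplus> \<one> = \<zero>" using mult_eq_zero a by blast
  then show ?thesis
  proof cases
    case 1 then show ?thesis using a by simp
  next
    case 2 then show ?thesis using a minus_equality[of a \<one>] by simp
  qed
qed

definition commutant :: "'a \<Rightarrow> 'a set" where
  "commutant x = {y \<in> carrier R. y \<otimes> x = x \<otimes> y}"

lemma commutant_closed: "y \<in> commutant x \<Longrightarrow> y \<in> carrier R"
  by (simp add: commutant_def)

lemma
  assumes x: "x \<in> carrier R"
  shows commutant_self: "x \<in> commutant x"
    and commutant_one: "\<one> \<in> commutant x"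
    and commutant_zero: "\<zero> \<in> commutant x"
    and commutant_add: "\<And>a b. \<lbrakk>a \<in> commutant x; b \<in> commutant x\<rbrakk> \<Longrightarrow> a \<oplus> b \<in> commutant x"
    and commutant_minus: "\<And>a b. \<lbrakk>a \<in> commutant x; b \<in> commutant x\<rbrakk> \<Longrightarrow> a \<ominus> b \<in> commutant x"
    and commutant_mult: "\<And>a b. \<lbrakk>a \<in> commutant x; b \<in> commutant x\<rbrakk> \<Longrightarrow> a \<otimes> b \<in> commutant x"
    and commutant_inv: "\<And>a. \<lbrakk>a \<in> commutant x; a \<noteq> \<zero>\<rbrakk> \<Longrightarrow> inv a \<in> commutant x"
proof -
  show "a \<oplus> b \<in> commutant x" if "a \<in> commutant x" "b \<in> commutant x" for a b
    using that x by (simp add: commutant_def l_distr r_distr)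
  show "a \<ominus> b \<in> commutant x" if "a \<in> commutant x" "b \<in> commutant x" for a b
    using that x by (simp add: commutant_def a_minus_def l_distr r_distr l_minus r_minus)
  show "a \<otimes> b \<in> commutant x" if "a \<in> commutant x" "b \<in> commutant x" for a b
    using that x by (auto simp: commutant_def) (metis m_assoc)
  show "inv a \<in> commutant x" if a: "a \<in> commutant x" "a \<noteq> \<zero>" for a
  proof -
    have ac: "a \<in> carrier R" "a \<otimes> x = x \<otimes> a" using a by (auto simp: commutant_def)
    note i = inv_nonzero[OF ac(1) a(2)]
    have "inv a \<otimes> x = inv a \<otimes> (x \<otimes> a) \<otimes> inv a" using i x ac(1) by (simp add: m_assoc)
    also have "\<dots> = inv a \<otimes> (a \<otimes> x) \<otimes> inv a" using ac by simp
    also have "\<dots> = x \<otimes> inv a" using i x ac(1) by (simp flip: m_assoc)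
    finally show ?thesis using i by (simp add: commutant_def)
  qed
qed (use x in \<open>auto simp: commutant_def\<close>)

lemma centre_eq: "ring_center R = (\<Inter>x\<in>carrier R. commutant x) \<inter> carrier R"
  by (auto simp: ring_center_def commutant_def)

lemma centre_closed: "a \<in> ring_center R \<Longrightarrow> a \<in> carrier R"
  by (simp add: ring_center_def)

lemma centre_subset_commutant: "x \<in> carrier R \<Longrightarrow> ring_center R \<subseteq> commutant x"
  by (auto simp: centre_eq)

lemma centre_commutes: "\<lbrakk>a \<in> ring_center R; x \<in> carrier R\<rbrakk> \<Longrightarrow> a \<otimes> x = x \<otimes> a"
  by (simp add: ring_center_def)

lemma
  shows centre_one: "\<one> \<in> ring_center R"
    and centre_zero: "\<zero> \<in> ring_center R"
    and centre_add: "\<lbrakk>a \<in> ring_center R; b \<in> ring_center R\<rbrakk> \<Longrightarrow> a \<oplus> b \<in> ring_center R"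
    and centre_minus: "\<lbrakk>a \<in> ring_center R; b \<in> ring_center R\<rbrakk> \<Longrightarrow> a \<ominus> b \<in> ring_center R"
    and centre_mult: "\<lbrakk>a \<in> ring_center R; b \<in> ring_center R\<rbrakk> \<Longrightarrow> a \<otimes> b \<in> ring_center R"
    and centre_inv: "\<lbrakk>a \<in> ring_center R; a \<noteq> \<zero>\<rbrakk> \<Longrightarrow> inv a \<in> ring_center R"
  unfolding centre_eq
  by (auto intro: commutant_one commutant_zero commutant_add commutant_minus commutant_mult commutant_inv
      inv_nonzero)

lemma subfield_centre: "subfield (ring_center R) R"
proof (rule subfieldI)
  show "subcring (ring_center R) R"
  proof (rule subcringI)
    show "subring (ring_center R) R"
    proof (rule subringI)
      show "\<ominus> h \<in> ring_center R" if "h \<in> ring_center R" for h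
        using centre_minus[OF centre_zero that] centre_closed[OF that] by (simp add: a_minus_def)
    qed (auto simp: centre_closed centre_one centre_mult centre_add)
    show "h1 \<otimes> h2 = h2 \<otimes> h1" if "h1 \<in> ring_center R" "h2 \<in> ring_center R" for h1 h2
      using that centre_commutes centre_closed by blast
  qed
  show "Units (R\<lparr>carrier := ring_center R\<rparr>) = ring_center R - {\<zero>}"
  proof (intro equalityI subsetI)
    fix a assume "a \<in> Units (R\<lparr>carrier := ring_center R\<rparr>)"
    then obtain b where "a \<in> ring_center R" "b \<in> ring_center R" "b \<otimes> a = \<one>"
      by (auto simp: Units_def)
    then show "a \<in> ring_center R - {\<zero>}" using one_neq_zero centre_closed r_null by auto
  next
    fix a assume a: "a \<in> ring_center R - {\<zero>}"
    then have "inv a \<in> ring_center R" "inv a \<otimes> a = \<one>" "a \<otimes> inv a = \<one>"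
      using centre_inv inv_nonzero centre_closed by auto
    with a show "a \<in> Units (R\<lparr>carrier := ring_center R\<rparr>)" by (auto simp: Units_def)
  qed
qed

end

locale quaternionic_skew_field = skew_field +
  assumes dimension_centre: "dimension 4 (ring_center R) (carrier R)"
begin

text \<open>
The commutant \<open>C\<close> of \<open>x\<close> is a skew field over which the algebra is a left vector space of
dimension at least \<open>2\<close>, because \<open>x\<close> is not central. So \<open>C\<close> has dimension at most \<open>2\<close> over the
centre and is spanned by \<open>x\<close> and \<open>\<one>\<close>. Concretely, if \<open>y \<in> C\<close> were not in this span and \<open>w \<notin> C\<close>,
then \<open>\<one>, x, y, w, x \<otimes> w\<close> would be five independent elements.
\<close>

lemma commutant_quadratic:
  assumes x: "x \<in> carrier R - ring_center R" and y: "y \<in> commutant x"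
  shows "\<exists>a\<in>ring_center R. \<exists>b\<in>ring_center R. y = a \<otimes> x \<oplus> b"
proof (rule ccontr)
  let ?F = "ring_center R"
  assume no: "\<not> ?thesis"
  have xc: "x \<in> carrier R" "x \<notin> ?F" using x by auto
  have yc: "y \<in> carrier R" using y by (rule commutant_closed)
  obtain w where w: "w \<in> carrier R" "w \<notin> commutant x"
    using xc by (auto simp: ring_center_def commutant_def)
  have span1: "Span ?F [\<one>] = ?F"
    by (auto simp: line_extension_mem_iff centre_closed)
  have span2: "Span ?F [x, \<one>] = {a \<otimes> x \<oplus> b |a b. a \<in> ?F \<and> b \<in> ?F}"
    using span1 by (auto simp: line_extension_mem_iff) blast+
  have span3: "Span ?F [y, x, \<one>] \<subseteq> commutant x"
  proof
    fix v assume "v \<in> Span ?F [y, x, \<one>]"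
    then obtain c u where c: "c \<in> ?F" "u \<in> Span ?F [x, \<one>]" "v = c \<otimes> y \<oplus> u"
      by (auto simp: line_extension_mem_iff)
    then obtain a b where "a \<in> ?F" "b \<in> ?F" "u = a \<otimes> x \<oplus> b" using span2 by auto
    with c show "v \<in> commutant x"
      using centre_subset_commutant[OF xc(1)] y
      by (auto intro!: commutant_add commutant_mult commutant_self xc)
  qed
  have "independent ?F [x \<otimes> w, w, y, x, \<one>]"
  proof (intro li_Cons li_Nil)
    show "\<one> \<notin> Span ?F []" using one_neq_zero by simp
    show "x \<notin> Span ?F [\<one>]" using span1 xc by simp
    show "y \<notin> Span ?F [x, \<one>]" unfolding span2 using no by auto
    show "w \<notin> Span ?F [y, x, \<one>]" using span3 w by blast
    show "x \<otimes> w \<notin> Span ?F [w, y, x, \<one>]"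
    proof
      assume "x \<otimes> w \<in> Span ?F [w, y, x, \<one>]"
      then obtain k v where k: "k \<in> ?F" "v \<in> Span ?F [y, x, \<one>]" "x \<otimes> w = k \<otimes> w \<oplus> v"
        by (auto simp: line_extension_mem_iff)
      have kc: "k \<in> carrier R" using k by (simp add: centre_closed)
      have v: "v \<in> commutant x" using k span3 by blast
      have vc: "v \<in> carrier R" using v by (rule commutant_closed)
      have "(x \<ominus> k) \<otimes> w = x \<otimes> w \<ominus> k \<otimes> w"
        using xc kc w by (simp add: a_minus_def l_distr l_minus)
      also have "\<dots> = v" using k kc w vc by (simp add: a_minus_def) algebra
      finally have eq: "(x \<ominus> k) \<otimes> w = v" .
      have xk: "x \<ominus> k \<in> commutant x"
        using centre_subset_commutant[OF xc(1)] k by (auto intro!: commutant_minus commutant_self xc)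
      have ne: "x \<ominus> k \<noteq> \<zero>" using xc kc k(1) by auto
      have "w = inv (x \<ominus> k) \<otimes> ((x \<ominus> k) \<otimes> w)"
        using inv_nonzero[OF commutant_closed[OF xk] ne] commutant_closed[OF xk] w
        by (simp flip: m_assoc)
      then have "w = inv (x \<ominus> k) \<otimes> v" using eq by simp
      then show False
        using commutant_mult[OF xc(1) commutant_inv[OF xc(1) xk ne] v] w by simp
    qed
  qed (use xc yc w in auto)
  then have "length [x \<otimes> w, w, y, x, \<one>] \<le> 4"
    using xc yc w by (intro independent_length_le_dimension[OF subfield_centre dimension_centre]) auto
  then show False by simp
qed

lemma commutant_comm:
  assumes x: "x \<in> carrier R - ring_center R" and y: "y \<in> commutant x" and z: "z \<in> commutant x"
  shows "y \<otimes> z = z \<otimes> y"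
proof -
  obtain a b where ab: "a \<in> ring_center R" "b \<in> ring_center R" "y = a \<otimes> x \<oplus> b"
    using commutant_quadratic[OF x y] by blast
  have xc: "x \<in> carrier R" using x by simp
  have zc: "z \<in> carrier R" using z by (rule commutant_closed)
  have "a \<in> commutant z" "b \<in> commutant z" "x \<in> commutant z"
    using ab centre_subset_commutant[OF zc] z xc by (auto simp: commutant_def)
  then have "y \<in> commutant z" unfolding ab by (intro commutant_add commutant_mult zc)
  then show ?thesis by (simp add: commutant_def)
qed

lemma quadratic_equation:
  assumes x: "x \<in> carrier R - ring_center R"
  obtains t n where "t \<in> ring_center R" "n \<in> ring_center R" "x \<otimes> x = t \<otimes> x \<oplus> n"
  using commutant_quadratic[OF x, of "x \<otimes> x"] commutant_mult[of x x x] commutant_self[of x] x by blast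

text \<open>
Conjugation preserves the quadratic equation \<open>x\<^sup>2 = t x + n\<close> of \<open>x\<close> over the centre. In the
commutative field \<open>commutant x\<close> this equation has no roots besides \<open>x\<close> and \<open>t \<ominus> x\<close>.
\<close>

lemma commuting_conjugate:
  assumes x: "x \<in> carrier R - ring_center R"
  obtains t where "t \<in> carrier R"
    "\<And>g. \<lbrakk>g \<in> Units R; g \<otimes> x \<otimes> inv g \<in> commutant x\<rbrakk>
       \<Longrightarrow> g \<otimes> x \<otimes> inv g = x \<or> g \<otimes> x \<otimes> inv g = t \<ominus> x"
proof -
  have xc: "x \<in> carrier R" using x by simp
  obtain t n where tn: "t \<in> ring_center R" "n \<in> ring_center R" "x \<otimes> x = t \<otimes> x \<oplus> n"
    using quadratic_equation[OF x] .
  have tc: "t \<in> carrier R" "n \<in> carrier R" using tn by (auto simp: centre_closed)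
  show thesis
  proof (rule that[OF tc(1)])
    fix g assume g: "g \<in> Units R" "g \<otimes> x \<otimes> inv g \<in> commutant x"
    define y where "y = g \<otimes> x \<otimes> inv g"
    have gc: "g \<in> carrier R" "inv g \<in> carrier R" using g by auto
    have yc: "y \<in> carrier R" using gc xc by (simp add: y_def)
    have yx: "y \<otimes> x = x \<otimes> y" using g by (simp add: y_def commutant_def)
    have "y \<otimes> y = g \<otimes> (x \<otimes> x) \<otimes> inv g"
    proof -
      have "y \<otimes> y = g \<otimes> x \<otimes> (inv g \<otimes> g) \<otimes> x \<otimes> inv g"
        unfolding y_def using gc xc by (simp only: m_assoc m_closed)
      then show ?thesis using g gc xc by (simp add: m_assoc)
    qed
    also have "\<dots> = (g \<otimes> t) \<otimes> x \<otimes> inv g \<oplus> (g \<otimes> n) \<otimes> inv g"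
      unfolding tn(3) using gc xc tc by (simp add: m_assoc l_distr r_distr)
    also have "\<dots> = (t \<otimes> g) \<otimes> x \<otimes> inv g \<oplus> (n \<otimes> g) \<otimes> inv g"
      using centre_commutes tn(1,2) gc by simp
    also have "\<dots> = t \<otimes> y \<oplus> n" using g gc xc tc by (simp add: y_def m_assoc)
    finally have yy: "y \<otimes> y = t \<otimes> y \<oplus> n" .
    have "(y \<ominus> x) \<otimes> (y \<ominus> (t \<ominus> x)) = (y \<otimes> y \<ominus> y \<otimes> t) \<oplus> (y \<otimes> x \<ominus> x \<otimes> y) \<oplus> (x \<otimes> t \<ominus> x \<otimes> x)"
      using xc yc tc by algebra
    also have "\<dots> = (t \<otimes> y \<oplus> n \<ominus> t \<otimes> y) \<oplus> (x \<otimes> y \<ominus> x \<otimes> y) \<oplus> (t \<otimes> x \<ominus> (t \<otimes> x \<oplus> n))"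
      using yx yy tn centre_commutes[OF tn(1)] xc yc by simp
    also have "\<dots> = \<zero>" using xc yc tc by algebra
    finally have "y \<ominus> x = \<zero> \<or> y \<ominus> (t \<ominus> x) = \<zero>" using xc yc tc by (intro mult_eq_zero) auto
    then show "g \<otimes> x \<otimes> inv g = x \<or> g \<otimes> x \<otimes> inv g = t \<ominus> x"
      using xc yc tc unfolding y_def[symmetric] by simp
  qed
qed

end

context quaternionic_skew_field
begin

lemma finite_subgroup_abelian_centralizers:
  assumes H: "subgroup H (units_of R)" "finite H"
  shows "abelian_centralizers ((units_of R)\<lparr>carrier := H\<rparr>)"
    and "\<And>x. x \<in> H \<Longrightarrow> monoid.centralizer ((units_of R)\<lparr>carrier := H\<rparr>) x = H \<inter> commutant x"
    and "H - monoid.centre ((units_of R)\<lparr>carrier := H\<rparr>) \<subseteq> carrier R - ring_center R"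
proof -
  let ?G = "(units_of R)\<lparr>carrier := H\<rparr>"
  interpret U: group "units_of R" by (rule units_group)
  interpret G: group ?G using H(1) by (rule U.subgroup_imp_group)
  have HU: "H \<subseteq> Units R" using subgroup.subset[OF H(1)] by (simp add: units_of_carrier)
  then have HR: "H \<subseteq> carrier R" by auto
  show cent: "G.centralizer x = H \<inter> commutant x" if "x \<in> H" for x
    using HR by (auto simp: G.centralizer_def commutant_def units_of_mult)
  have conj: "G.conj g x = g \<otimes> x \<otimes> inv g" if "g \<in> H" "x \<in> H" for g x
    using that HU U.m_inv_consistent[OF H(1) that(1)] units_of_inv
    by (auto simp: G.conj_def units_of_mult)
  show nc: "H - G.centre \<subseteq> carrier R - ring_center R"
    using HR by (auto simp: G.centre_def ring_center_def units_of_mult)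
  show "abelian_centralizers ?G"
  proof unfold_locales
    show "finite (carrier ?G)" using H(2) by simp
  next
    fix x y z assume "x \<in> carrier ?G - G.centre" "y \<in> G.centralizer x" "z \<in> G.centralizer x"
    then show "y \<otimes>\<^bsub>?G\<^esub> z = z \<otimes>\<^bsub>?G\<^esub> y"
      using nc cent commutant_comm[of x y z] by (auto simp: units_of_mult)
  next
    fix x g h
    assume x: "x \<in> carrier ?G - G.centre" and gh: "g \<in> carrier ?G" "h \<in> carrier ?G"
      and c: "G.conj g x \<in> G.centralizer x" "G.conj h x \<in> G.centralizer x"
      and n: "G.conj g x \<noteq> x" "G.conj h x \<noteq> x"
    have xH: "x \<in> H" "x \<in> carrier R - ring_center R" using x nc by auto
    have ghH: "g \<in> H" "h \<in> H" "g \<in> Units R" "h \<in> Units R" using gh HU by auto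
    obtain t where "\<And>g. \<lbrakk>g \<in> Units R; g \<otimes> x \<otimes> inv g \<in> commutant x\<rbrakk>
        \<Longrightarrow> g \<otimes> x \<otimes> inv g = x \<or> g \<otimes> x \<otimes> inv g = t \<ominus> x"
      using commuting_conjugate[OF xH(2)] by blast
    then show "G.conj g x = G.conj h x"
      using c n ghH xH cent conj by (metis IntD2)
  qed
qed

end


section \<open>Roots of unity in quadratic fields over the rational numbers\<close>

lemma prime_not_rat_square:
  fixes t :: rat
  assumes p: "Factorial_Ring.prime p" shows "t * t \<noteq> of_nat p"
proof
  assume eq: "t * t = of_nat p"
  obtain a b where ab: "t = Rat.Fract a b" "b > 0" "coprime a b"
    using Rat_cases by blast
  then have "Rat.Fract (a * a) (b * b) = Rat.Fract (int p) 1"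
    using eq by (simp add: of_nat_rat)
  then have s: "a * a = int p * (b * b)" using ab(2) by (simp add: eq_rat)
  have pr: "Factorial_Ring.prime (int p)" using p by simp
  have "int p dvd a * a" using s by simp
  then have pa: "int p dvd a" using prime_dvd_multD[OF pr] by blast
  then obtain k where k: "a = int p * k" by blast
  have "int p * (b * b) = int p * (int p * k * k)" using s unfolding k by (simp only: mult_ac)
  then have "b * b = int p * k * k" using pr by (metis mult_cancel_left not_prime_0)
  then have "int p dvd b * b" by simp
  then have "int p dvd b" using prime_dvd_multD[OF pr] by blast
  with pa ab(3) pr show False using coprime_common_divisor not_prime_unit by blast
qed

lemma rat_square_1_minus_1:
  fixes q :: rat shows "q * q = 1 \<Longrightarrow> q = 1 \<or> q = - 1" "q * q \<noteq> - 1"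
  by (simp add: square_eq_1_iff, metis neg_0_le_iff_le not_one_le_zero zero_le_square)

text \<open>
The hypotheses say that the fourth power of a root of \<open>X\<^sup>2 - t X - n\<close> is \<open>1\<close> or \<open>-1\<close>, expressed in
the basis of the root and \<open>1\<close>. The solution with \<open>t \<noteq> 0\<close> would be a primitive eighth root of
unity, which needs \<open>\<surd>2\<close> or \<open>\<surd>-2\<close>.
\<close>

lemma rat_eighth_root:
  fixes t n :: rat
  assumes A: "t * t * t + 2 * (t * n) = 0" and B: "(t * t * n + n * n) = 1 \<or> (t * t * n + n * n) = - 1"
  shows "t = 0 \<and> (n = 1 \<or> n = - 1)"
proof (cases "t = 0")
  case True
  then show ?thesis using B rat_square_1_minus_1 by auto
next
  case False
  have "t * (t * t + 2 * n) = 0" using A by (simp add: algebra_simps)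
  then have tt: "t * t = - 2 * n" using False by simp
  then have "t * t * n = - 2 * (n * n)" by simp
  then have "n * n = 1 \<or> n * n = - 1" using B by auto
  then have "n = 1 \<or> n = - 1" using rat_square_1_minus_1 by blast
  then show ?thesis
  proof
    assume "n = 1"
    then show ?thesis using tt zero_le_square[of t] by simp
  next
    assume "n = - 1"
    then have "t * t = of_nat 2" using tt by simp
    then show ?thesis using prime_not_rat_square[OF two_is_prime_nat] by blast
  qed
qed

text \<open>
The hypothesis says that the fifth power of a root of \<open>X\<^sup>2 - t X - n\<close> has no component along the
root. Completing the square turns it into \<open>(2 n + 3 t\<^sup>2)\<^sup>2 = 5 t\<^sup>4\<close>, which needs \<open>\<surd>5\<close>.
\<close>

lemma rat_tenth_root:
  fixes t n :: rat
  assumes A: "t * t * t * t + 3 * (t * t * n) + n * n = 0"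
  shows "t = 0 \<and> n = 0"
proof (cases "t = 0")
  case True
  then show ?thesis using A by simp
next
  case False
  define u where "u = 2 * n + 3 * (t * t)"
  have "u * u = 5 * (t * t) * (t * t) + 4 * (t * t * t * t + 3 * (t * t * n) + n * n)"
    by (simp add: u_def algebra_simps)
  then have "u * u = 5 * (t * t) * (t * t)" using A by simp
  then have "u / (t * t) * (u / (t * t)) = of_nat 5"
    using False by simp
  moreover have "Factorial_Ring.prime (5::nat)" by (simp add: prime_nat_numeral_eq)
  ultimately show ?thesis using prime_not_rat_square by blast
qed


locale rational_quaternions = quaternionic_skew_field +
  fixes \<phi> :: "rat \<Rightarrow> 'a"
  assumes hom: "\<phi> \<in> ring_hom rat_field R" and range: "range \<phi> = ring_center R"
begin

lemma phi_closed [simp]: "\<phi> q \<in> carrier R"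
  using ring_hom_closed[OF hom] by (simp add: ring_of_type_algebra_def)

lemma phi_centre: "\<phi> q \<in> ring_center R"
  using range by blast

lemma phi_add: "\<phi> (p + q) = \<phi> p \<oplus> \<phi> q"
  using ring_hom_add[OF hom] by (simp add: ring_of_type_algebra_def)

lemma phi_mult: "\<phi> (p * q) = \<phi> p \<otimes> \<phi> q"
  using ring_hom_mult[OF hom] by (simp add: ring_of_type_algebra_def)

lemma phi_one: "\<phi> 1 = \<one>"
  using ring_hom_one[OF hom] by (simp add: ring_of_type_algebra_def)

lemma phi_zero: "\<phi> 0 = \<zero>"
proof -
  have "\<phi> 0 \<oplus> \<phi> 0 = \<phi> 0" by (simp flip: phi_add)
  then show ?thesis by (simp add: add.r_cancel_one)
qed

lemma phi_minus: "\<phi> (- q) = \<ominus> \<phi> q"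
proof -
  have "\<phi> (- q) \<oplus> \<phi> q = \<zero>" by (simp flip: phi_add add: phi_zero)
  then show ?thesis using minus_equality[of "\<phi> (- q)" "\<phi> q"] by simp
qed

lemma phi_eq_zero: "\<phi> q = \<zero> \<Longrightarrow> q = 0"
proof (rule ccontr)
  assume "\<phi> q = \<zero>" "q \<noteq> 0"
  then have "\<phi> (q * inverse q) = \<zero>" by (simp only: phi_mult l_null phi_closed)
  then show False using \<open>q \<noteq> 0\<close> one_neq_zero by (simp add: phi_one)
qed

lemma phi_inject: "\<phi> p = \<phi> q \<longleftrightarrow> p = q"
proof
  assume "\<phi> p = \<phi> q"
  then have "\<phi> (p + - q) = \<zero>" by (simp only: phi_add phi_minus r_neg phi_closed)
  then show "p = q" using phi_eq_zero by fastforce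
qed simp

lemma linear_coefficients_unique:
  assumes x: "x \<in> carrier R - ring_center R"
    and eq: "\<phi> a \<otimes> x \<oplus> \<phi> b = \<phi> d"
  shows "a = 0 \<and> b = d"
proof -
  have xc: "x \<in> carrier R" using x by simp
  have a: "a = 0"
  proof (rule ccontr)
    assume "a \<noteq> 0"
    have "\<phi> a \<otimes> x = \<phi> a \<otimes> x \<oplus> \<phi> b \<ominus> \<phi> b" using xc by (simp add: a_minus_def a_assoc r_neg)
    also have "\<dots> = \<phi> (d + - b)" by (simp only: eq phi_add phi_minus a_minus_def)
    finally have "\<phi> (inverse a) \<otimes> (\<phi> a \<otimes> x) = \<phi> (inverse a * (d + - b))" by (simp only: phi_mult)
    then have "\<phi> (inverse a * a) \<otimes> x = \<phi> (inverse a * (d + - b))"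
      using xc by (simp only: phi_mult m_assoc phi_closed)
    then have "x = \<phi> (inverse a * (d + - b))" using \<open>a \<noteq> 0\<close> xc by (simp add: phi_one)
    then show False using x phi_centre by simp
  qed
  with eq xc show ?thesis by (simp add: phi_zero phi_inject)
qed

lemma linear_times:
  assumes x: "x \<in> carrier R" and eq: "x \<otimes> x = \<phi> t \<otimes> x \<oplus> \<phi> n"
  shows "(\<phi> a \<otimes> x \<oplus> \<phi> b) \<otimes> x = \<phi> (a * t + b) \<otimes> x \<oplus> \<phi> (a * n)"
proof -
  have "(\<phi> a \<otimes> x \<oplus> \<phi> b) \<otimes> x = \<phi> a \<otimes> (x \<otimes> x) \<oplus> \<phi> b \<otimes> x"
    using x by (simp add: l_distr m_assoc)
  also have "\<dots> = \<phi> a \<otimes> (\<phi> t \<otimes> x) \<oplus> \<phi> a \<otimes> \<phi> n \<oplus> \<phi> b \<otimes> x"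
    unfolding eq using x by (simp add: r_distr)
  also have "\<dots> = (\<phi> (a * t) \<otimes> x \<oplus> \<phi> b \<otimes> x) \<oplus> \<phi> (a * n)"
    using x by (simp add: phi_mult m_assoc a_ac)
  also have "\<dots> = \<phi> (a * t + b) \<otimes> x \<oplus> \<phi> (a * n)" using x by (simp add: phi_add l_distr)
  finally show ?thesis .
qed

text \<open>
Powers of \<open>x\<close> in the basis \<open>x, \<one>\<close> of the quadratic field that it generates.
\<close>

lemma power_coefficients:
  assumes x: "x \<in> carrier R - ring_center R"
  obtains t n where "x \<otimes> x = \<phi> t \<otimes> x \<oplus> \<phi> n"
    "x [^] (4::nat) = \<phi> (t * t * t + 2 * (t * n)) \<otimes> x \<oplus> \<phi> (t * t * n + n * n)"
    "x [^] (5::nat) = \<phi> (t * t * t * t + 3 * (t * t * n) + n * n) \<otimes> x \<oplus> \<phi> ((t * t * t + 2 * (t * n)) * n)"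
proof -
  have xc: "x \<in> carrier R" using x by simp
  obtain t n where eq: "x \<otimes> x = \<phi> t \<otimes> x \<oplus> \<phi> n"
    using quadratic_equation[OF x] range by (metis imageE)
  have p2: "x [^] (2::nat) = \<phi> t \<otimes> x \<oplus> \<phi> n" using eq xc by (simp add: numeral_2_eq_2)
  have p3: "x [^] (3::nat) = \<phi> (t * t + n) \<otimes> x \<oplus> \<phi> (t * n)"
    using linear_times[OF xc eq, of t n] p2 by (simp add: numeral_3_eq_3 numeral_2_eq_2)
  have "x [^] (4::nat) = x [^] (3::nat) \<otimes> x" by (simp add: eval_nat_numeral)
  also have "\<dots> = \<phi> ((t * t + n) * t + t * n) \<otimes> x \<oplus> \<phi> ((t * t + n) * n)"
    unfolding p3 by (rule linear_times[OF xc eq])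
  finally have p4: "x [^] (4::nat) = \<phi> (t * t * t + 2 * (t * n)) \<otimes> x \<oplus> \<phi> (t * t * n + n * n)"
    by (simp add: algebra_simps)
  have "x [^] (5::nat) = x [^] (4::nat) \<otimes> x" by (simp add: eval_nat_numeral)
  also have "\<dots> = \<phi> ((t * t * t + 2 * (t * n)) * t + (t * t * n + n * n)) \<otimes> x
      \<oplus> \<phi> ((t * t * t + 2 * (t * n)) * n)"
    unfolding p4 by (rule linear_times[OF xc eq])
  finally have "x [^] (5::nat) = \<phi> (t * t * t * t + 3 * (t * t * n) + n * n) \<otimes> x
      \<oplus> \<phi> ((t * t * t + 2 * (t * n)) * n)"
    by (simp add: algebra_simps)
  with eq p4 show thesis by (rule that)
qed

text \<open>
A quadratic field over the rational numbers contains no primitive eighth root of unity, so \<open>x\<close>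
has order \<open>4\<close>.
\<close>

lemma eighth_root:
  assumes x: "x \<in> carrier R - ring_center R" and p: "x [^] (8::nat) = \<one>"
  shows "x \<otimes> x = \<ominus> \<one>"
proof -
  have xc: "x \<in> carrier R" using x by simp
  obtain t n where eq: "x \<otimes> x = \<phi> t \<otimes> x \<oplus> \<phi> n"
    and p4: "x [^] (4::nat) = \<phi> (t * t * t + 2 * (t * n)) \<otimes> x \<oplus> \<phi> (t * t * n + n * n)"
    using power_coefficients[OF x] .
  have "x [^] (4::nat) \<otimes> x [^] (4::nat) = \<one>" using xc p by (simp add: nat_pow_mult)
  then have "x [^] (4::nat) = \<phi> 1 \<or> x [^] (4::nat) = \<phi> (- 1)"
    unfolding phi_one phi_minus by (rule square_eq_one[OF nat_pow_closed[OF xc]])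
  then have "t * t * t + 2 * (t * n) = 0 \<and> (t * t * n + n * n = 1 \<or> t * t * n + n * n = - 1)"
    using linear_coefficients_unique[OF x] unfolding p4 by blast
  then have "t = 0 \<and> (n = 1 \<or> n = - 1)" using rat_eighth_root by blast
  then have "x \<otimes> x = \<one> \<or> x \<otimes> x = \<ominus> \<one>"
    using eq xc by (auto simp: phi_zero phi_one phi_minus)
  moreover have "x \<otimes> x \<noteq> \<one>"
  proof
    assume "x \<otimes> x = \<one>"
    then have "x = \<phi> 1 \<or> x = \<phi> (- 1)" using square_eq_one xc by (simp add: phi_one phi_minus)
    then show False using x phi_centre by auto
  qed
  ultimately show ?thesis by blast
qed

lemma tenth_root:
  assumes x: "x \<in> carrier R" and p: "x [^] (10::nat) = \<one>"
  shows "x \<in> ring_center R"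
proof (rule ccontr)
  assume "x \<notin> ring_center R"
  with x have x: "x \<in> carrier R - ring_center R" by simp
  then have xc: "x \<in> carrier R" by simp
  obtain t n where p5: "x [^] (5::nat) = \<phi> (t * t * t * t + 3 * (t * t * n) + n * n) \<otimes> x
      \<oplus> \<phi> ((t * t * t + 2 * (t * n)) * n)"
    using power_coefficients[OF x] .
  have "x [^] (5::nat) \<otimes> x [^] (5::nat) = \<one>" using xc p by (simp add: nat_pow_mult)
  then have "x [^] (5::nat) = \<phi> 1 \<or> x [^] (5::nat) = \<phi> (- 1)"
    unfolding phi_one phi_minus by (rule square_eq_one[OF nat_pow_closed[OF xc]])
  moreover have "t * t * t * t + 3 * (t * t * n) + n * n = 0 \<and> (t * t * t + 2 * (t * n)) * n = d"
    if "x [^] (5::nat) = \<phi> d" for d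
    using that unfolding p5 by (rule linear_coefficients_unique[OF x])
  ultimately have "t * t * t * t + 3 * (t * t * n) + n * n = 0"
    and B: "(t * t * t + 2 * (t * n)) * n = 1 \<or> (t * t * t + 2 * (t * n)) * n = - 1"
    by blast+
  then have "t = 0 \<and> n = 0" using rat_tenth_root by blast
  with B show False by simp
qed

end

context rational_quaternions
begin

lemma phi_pow: "\<phi> (q ^ m) = \<phi> q [^] (m::nat)"
  by (induction m) (simp_all add: phi_one phi_mult power_Suc2 del: power_Suc)

text \<open>
The values \<open>24\<close> and \<open>60\<close> would need a centralizer of order \<open>4\<close> or \<open>5\<close> modulo the centre. The
centre of a nonabelian finite group of rational quaternions consists of rational numbers of
finite order, that is, of \<open>\<one>\<close> and possibly \<open>\<ominus> \<one>\<close>. So the elements \<open>y\<close> of the centralizer satisfy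
\<open>y\<^sup>8 = \<one>\<close> or \<open>y\<^sup>1\<^sup>0 = \<one>\<close>. In the first case the noncentral ones are among the two square roots of
\<open>\<ominus> \<one>\<close> in a field, which is too few; in the second case there are none.
\<close>

lemma rational_group_index:
  assumes H: "subgroup H (units_of R)" "finite H"
  shows "\<exists>d\<in>{1, 2, 12}. least_abelian_index ((units_of R)\<lparr>carrier := H\<rparr>) d"
proof -
  let ?G = "(units_of R)\<lparr>carrier := H\<rparr>"
  interpret U: group "units_of R" by (rule units_group)
  interpret G: abelian_centralizers ?G using H by (rule finite_subgroup_abelian_centralizers)
  note cent = finite_subgroup_abelian_centralizers(2)[OF H]
  note nc = finite_subgroup_abelian_centralizers(3)[OF H]
  have HU: "H \<subseteq> Units R" using subgroup.subset[OF H(1)] by (simp add: units_of_carrier)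
  then have HR: "H \<subseteq> carrier R" by auto
  have no: False if x: "x \<in> H - G.centre" and k: "k = 4 \<or> k = 5"
    and c: "card (G.centralizer x) = k * card G.centre" for x k
  proof -
    have xH: "x \<in> H" and xc: "x \<in> carrier R - ring_center R" using x nc by auto
    have pow: "y [^]\<^bsub>?G\<^esub> m = y [^] m" if "y \<in> H" for y and m :: nat
      using that HU units_of_pow by (metis U.nat_pow_consistent subsetD)
    have root: "y [^] (2 * k) = \<one>" if y: "y \<in> G.centralizer x" "card G.centre dvd 2" for y
    proof -
      interpret C: group "?G\<lparr>carrier := G.centralizer x\<rparr>"
        using G.subgroup_centralizer xH by (intro G.subgroup_imp_group) simp
      have yH: "y \<in> H" using y cent[OF xH] by blast
      have "y [^]\<^bsub>?G\<lparr>carrier := G.centralizer x\<rparr>\<^esub> card (G.centralizer x) = \<one>"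
        using C.pow_order_eq_1[of y] y by (simp add: Coset.order_def units_of_one)
      then have "y [^] card (G.centralizer x) = \<one>"
        using pow[OF yH] G.nat_pow_consistent[of y _ "G.centralizer x"] by simp
      moreover obtain j where "2 = card G.centre * j" using y(2) by (elim dvdE)
      then have "2 * k = card (G.centralizer x) * j" unfolding c by simp
      ultimately show ?thesis using yH HR by (simp add: nat_pow_pow[symmetric] subset_iff)
    qed
    \<comment> \<open>A central element of the group that is not in the centre of the algebra would have a
      commutative commutant containing the whole group.\<close>
    have centre2: "G.centre \<subseteq> {\<one>, \<ominus> \<one>}"
    proof
      fix u assume u: "u \<in> G.centre"
      have uH: "u \<in> H" using u by (simp add: G.centre_def)
      have uR: "u \<in> ring_center R"
      proof (rule ccontr)
        assume "u \<notin> ring_center R"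
        then have u': "u \<in> carrier R - ring_center R" using uH HR by auto
        have "y \<in> commutant u" if "y \<in> H" for y
          using u that HR by (auto simp: G.centre_def commutant_def units_of_mult)
        then have "y \<otimes> z = z \<otimes> y" if "y \<in> H" "z \<in> H" for y z
          using commutant_comm[OF u'] that by blast
        then have "x \<in> G.centre" using xH by (simp add: G.centre_def units_of_mult)
        then show False using x by simp
      qed
      then obtain q where q: "u = \<phi> q" using range by blast
      have "u [^] card H = \<one>"
        using G.pow_order_eq_1[of u] uH pow[OF uH] by (simp add: Coset.order_def units_of_one)
      then have "q ^ card H = 1" by (simp add: q phi_inject flip: phi_pow phi_one)
      then have "\<bar>q\<bar> ^ card H = 1" by (simp flip: power_abs)
      moreover have "card H > 0" using uH H(2) card_gt_0_iff by blast
      ultimately have "\<bar>q\<bar> = 1" using power_eq_imp_eq_base[of "\<bar>q\<bar>" "card H" 1] by simp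
      then have "q = 1 \<or> q = - 1" by linarith
      then show "u \<in> {\<one>, \<ominus> \<one>}" using q by (auto simp: phi_one phi_minus)
    qed
    have "card G.centre \<le> 2"
      using card_mono[OF _ centre2] card_insert_le_m1[of 2 "{\<ominus> \<one>}" \<one>] by simp
    moreover have "card G.centre > 0" by (rule G.card_centre_pos)
    ultimately have "card G.centre = 1 \<or> card G.centre = 2" by linarith
    then have centre_dvd: "card G.centre dvd 2" by auto
    have x_self: "x \<in> G.centralizer x" using xH by (simp add: G.centralizer_def)
    from k show False
    proof
      assume "k = 5"
      then have "x [^] (10::nat) = \<one>" using root[OF x_self centre_dvd] by simp
      then show False using tenth_root xc by blast
    next
      assume k4: "k = 4"
      have minus: "y \<otimes> y = \<ominus> \<one>" if y: "y \<in> G.centralizer x - G.centre" for y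
      proof (rule eighth_root)
        show "y \<in> carrier R - ring_center R" using y nc cent[OF xH] by blast
        show "y [^] (8::nat) = \<one>" using root[of y] y centre_dvd k4 by simp
      qed
      have "G.centralizer x - G.centre \<subseteq> {x, \<ominus> x}"
      proof
        fix y assume y: "y \<in> G.centralizer x - G.centre"
        have xR: "x \<in> carrier R" using xc by simp
        have yR: "y \<in> carrier R" and comm: "y \<otimes> x = x \<otimes> y"
          using y cent[OF xH] by (auto simp: commutant_def)
        have "(y \<ominus> x) \<otimes> (y \<oplus> x) = (y \<otimes> y \<ominus> x \<otimes> x) \<oplus> (y \<otimes> x \<ominus> x \<otimes> y)"
          using xR yR by algebra
        also have "\<dots> = \<zero>" using minus[OF y] minus[of x] x x_self comm xR yR
          by (simp add: a_minus_def r_neg l_neg)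
        finally have "y \<ominus> x = \<zero> \<or> y \<oplus> x = \<zero>" using xR yR by (intro mult_eq_zero) auto
        then show "y \<in> {x, \<ominus> x}"
        proof
          assume "y \<ominus> x = \<zero>"
          then show ?thesis using xR yR by simp
        next
          assume "y \<oplus> x = \<zero>"
          then have "\<ominus> x = y" using xR yR by (intro minus_equality)
          then show ?thesis by simp
        qed
      qed
      then have "card (G.centralizer x - G.centre) \<le> card {x, \<ominus> x}"
        by (intro card_mono) auto
      also have "\<dots> \<le> 2" by (simp add: card_insert_if)
      finally have few: "card (G.centralizer x - G.centre) \<le> 2" .
      have "finite G.centre" using H(2) by (simp add: G.centre_def)
      then have "card (G.centralizer x - G.centre) = card (G.centralizer x) - card G.centre"
        using G.centre_subset_centralizer[of x] xH by (intro card_Diff_subset) auto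
      then show False using few c \<open>card G.centre > 0\<close> unfolding k4 by linarith
    qed
  qed
  show ?thesis
    using G.least_abelian_index_cases no[of _ 4] no[of _ 5] by auto
qed

end


section \<open>Jordan constants\<close>

text \<open>
The Jordan constant is the maximum of the optimal constants of the finite subgroups. These lie
in a finite set, so the maximum exists and is attained.
\<close>

lemma jordan_constant_among_indices:
  assumes G: "group G" and S: "finite S" "1 \<in> S"
    and index: "\<And>H. \<lbrakk>subgroup H G; finite H\<rbrakk> \<Longrightarrow> \<exists>d\<in>S. least_abelian_index (G\<lparr>carrier := H\<rparr>) d"
  shows "jordan_group G \<and> jordan_constant G \<in> S"
proof -
  have bound: "jordan_bound G (Max S)"
    unfolding jordan_bound_def
  proof (intro allI impI)
    fix H assume "subgroup H G \<and> finite H"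
    then obtain d where "d \<in> S" "least_abelian_index (G\<lparr>carrier := H\<rparr>) d" using index by blast
    moreover have "d \<le> Max S" using S \<open>d \<in> S\<close> by simp
    ultimately show "\<exists>A. A \<lhd> G\<lparr>carrier := H\<rparr> \<and> comm_group (G\<lparr>carrier := A\<rparr>) \<and>
        card (rcosets\<^bsub>G\<lparr>carrier := H\<rparr>\<^esub> A) \<le> Max S"
      unfolding least_abelian_index_def by auto
  qed
  have pos: "Max S > 0" using S Max_ge[of S 1] by linarith
  define c where "c = jordan_constant G"
  have c: "c > 0" "jordan_bound G c"
    using LeastI[of "\<lambda>d. d > 0 \<and> jordan_bound G d" "Max S"] bound pos
    by (auto simp: c_def jordan_constant_def)
  have minimal: "c \<le> d" if "d > 0" "jordan_bound G d" for d
    using that unfolding c_def jordan_constant_def by (intro Least_le) blast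
  have "c \<in> S"
  proof (cases "c = 1")
    case False
    then have "\<not> jordan_bound G (c - 1)" using minimal[of "c - 1"] c(1) by linarith
    then obtain H where H: "subgroup H G" "finite H"
      and none: "\<And>A. \<lbrakk>A \<lhd> G\<lparr>carrier := H\<rparr>; comm_group (G\<lparr>carrier := A\<rparr>)\<rbrakk>
        \<Longrightarrow> \<not> card (rcosets\<^bsub>G\<lparr>carrier := H\<rparr>\<^esub> A) \<le> c - 1"
      unfolding jordan_bound_def by blast
    obtain d where d: "d \<in> S" "least_abelian_index (G\<lparr>carrier := H\<rparr>) d" using index[OF H] by blast
    obtain A where "A \<lhd> G\<lparr>carrier := H\<rparr>" "comm_group (G\<lparr>carrier := A\<rparr>)"
        "card (rcosets\<^bsub>G\<lparr>carrier := H\<rparr>\<^esub> A) = d"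
      using d(2) unfolding least_abelian_index_def by auto
    then have "\<not> d \<le> c - 1" using none by blast
    moreover obtain B where "B \<lhd> G\<lparr>carrier := H\<rparr>" "comm_group (G\<lparr>carrier := B\<rparr>)"
        "card (rcosets\<^bsub>G\<lparr>carrier := H\<rparr>\<^esub> B) \<le> c"
      using c(2) H unfolding jordan_bound_def by blast
    then have "d \<le> c" using d(2) unfolding least_abelian_index_def by fastforce
    ultimately show ?thesis using d(1) by (metis One_nat_def Suc_pred c(1) le_SucE diff_Suc_1)
  qed (use S in simp)
  then show ?thesis using G bound pos by (auto simp: jordan_group_def c_def)
qed

lemma quaternionic_skew_field_of_division_algebra:
  assumes "quaternion_division_algebra K D \<phi>"
  shows "quaternionic_skew_field D"
proof -
  have "ring D" "Units D = carrier D - {\<zero>\<^bsub>D\<^esub>}" "ring.dimension D 4 (ring_center D) (carrier D)"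
    using assms
    by (auto simp: quaternion_division_algebra_def quaternion_algebra_def simple_ring_def)
  then show ?thesis
    by (simp add: quaternionic_skew_field_def quaternionic_skew_field_axioms_def
        skew_field_def skew_field_axioms_def)
qed

theorem theorem1p1:
  shows "(\<forall>(D :: ('a, 'm) ring_scheme) \<phi>.
            quaternion_division_algebra rat_field D \<phi> \<longrightarrow>
              jordan_group (units_of D) \<and> jordan_constant (units_of D) \<in> {1, 2, 12}) \<and>
         (\<forall>(K :: ('k, 'l) ring_scheme) (D :: ('b, 'n) ring_scheme) \<phi>.
            quadratic_number_field K \<and> quaternion_division_algebra K D \<phi> \<longrightarrow>
              jordan_group (units_of D) \<and> jordan_constant (units_of D) \<in> {1, 2, 12, 24, 60})"
proof (rule conjI; intro allI impI)
  fix D :: "('a, 'm) ring_scheme" and \<phi>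
  assume D: "quaternion_division_algebra rat_field D \<phi>"
  then interpret quaternionic_skew_field D by (rule quaternionic_skew_field_of_division_algebra)
  interpret rational_quaternions D \<phi>
    using D by unfold_locales
      (auto simp: quaternion_division_algebra_def quaternion_algebra_def ring_of_type_algebra_def)
  show "jordan_group (units_of D) \<and> jordan_constant (units_of D) \<in> {1, 2, 12}"
    by (rule jordan_constant_among_indices[OF units_group _ _ rational_group_index]) auto
next
  fix K :: "('k, 'l) ring_scheme" and D :: "('b, 'n) ring_scheme" and \<phi>
  assume "quadratic_number_field K \<and> quaternion_division_algebra K D \<phi>"
  then interpret quaternionic_skew_field D
    using quaternionic_skew_field_of_division_algebra by blast
  have "\<exists>d\<in>{1, 2, 12, 24, 60}. least_abelian_index ((units_of D)\<lparr>carrier := H\<rparr>) d"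
    if "subgroup H (units_of D)" "finite H" for H
    using abelian_centralizers.least_abelian_index_cases[OF finite_subgroup_abelian_centralizers(1)[OF that]]
    by blast
  then show "jordan_group (units_of D) \<and> jordan_constant (units_of D) \<in> {1, 2, 12, 24, 60}"
    by (intro jordan_constant_among_indices[OF units_group]) auto
qed

end
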